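(* Consider a stochastic shortest path problem as in the context satisfying Assumptions (A1), (A2) and (A4). Let $(J_t)$ be generated by the algorithm of the context (with $\alpha=1$), with step sizes $\gamma_t(i)=\beta(n_t(i))$ or $\gamma_t(i)=\beta(t)$. Then $J_t(i)\to J^*(i)$ almost surely for every $i\in S$.
   Context: The state space is $S\cup\{0\}$ with $S=\{1,\dots,n\}$; action sets $\mathcal A(i)$ are finite and nonempty, transition probabilities are $P_{ij}(u)$ and costs $c(i,u)\ge0$ are deterministic. A policy $\mu$ ($\mu(i)\in\mathcal A(i)$) induces a Markov chain $X^\mu$ with transition probabilities $P_{ij}(\mu(i))$. Undiscounted costs: $J^\mu(i)=\mathbb E[\sum_{k\ge0}c(X^\mu_k,\mu(X^\mu_k))\mid X^\mu_0=i]$, $J^*(i)=\min_\mu J^\mu(i)$, which satisfies $J^*(i)=\min_u[c(i,u)+\sum_jP_{ij}(u)J^*(j)]$. Assumption (A4): state $0$ is absorbing and incurs cost $0$ under every action, and the subgraph of the reachability graph $G$ (directed graph with an edge $(i,j)$ iff $P_{ij}(u)>0$ for some $u$) induced by $S$ is acyclic. A fixed distribution $p$ is the initial distribution for all policies; $q_\mu(i)$ is the probability that $X^\mu$ with $X^\mu_0\sim p$ ever visits $i$. Assumption (A1): $q_\mu(i)>0$ for all policies $\mu$ and all $i\in S$. Assumption (A2): for all $i,j$ and $u,v\in\mathcal A(i)$, $P_{ij}(u)>0$ iff $P_{ij}(v)>0$. Algorithm ($\alpha=1$): $J_0=0$ (with $J_t(0)=0$). At iteration $t$: take $\mu_t$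 greedy w.r.t. $J_t$, i.e. $\mu_t(i)\in\arg\min_u[c(i,u)+\sum_jP_{ij}(u)J_t(j)]$; independently draw $X^{\mu_t}_0\sim p$ and simulate a trajectory under $\mu_t$; with $N_t(i)=\inf\{k:X^{\mu_t}_k=i\}$ and $\tilde J^{\mu_t}(i)=\sum_{k\ge N_t(i)}c(X^{\mu_t}_k,\mu_t(X^{\mu_t}_k))$ when $N_t(i)<\infty$, set $J_{t+1}(i)=(1-\gamma_t(i))J_t(i)+\gamma_t(i)\tilde J^{\mu_t}(i)$ if $N_t(i)<\infty$ and $J_{t+1}(i)=J_t(i)$ otherwise. Step sizes: $\beta:\mathbb N\to(0,1]$ deterministic with $\sum_t\beta(t)=\infty$, $\sum_t\beta(t)^2<\infty$, $\beta$ nonincreasing for $t>T_0$; $n_t(i)$ is the number of iterations $\tau<t$ whose trajectory visited $i$. *)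

theory Defs
  imports "HOL-Probability.Probability"
begin

text \<open>States are natural numbers: S = {1..n}, the absorbing state is 0.
  Actions have type 'a; A :: nat => 'a set gives the admissible actions;
  P i u j is the transition probability, c i u the cost, p the initial distribution.
  A (deterministic stationary) policy is a function mu :: nat => 'a.
  Under (A4) every trajectory visits distinct states of S and is then absorbed in 0,
  so a trajectory is encoded by the finite list of states of S it visits, in order.\<close>

definition policies :: "nat \<Rightarrow> (nat \<Rightarrow> 'a set) \<Rightarrow> (nat \<Rightarrow> 'a) set" where
  "policies n A = {mu. \<forall>i\<in>{1..n}. mu i \<in> A i}"

fun pathprob :: "(nat \<Rightarrow> 'a \<Rightarrow> nat \<Rightarrow> real) \<Rightarrow> (nat \<Rightarrow> 'a) \<Rightarrow> nat list \<Rightarrow> real" where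
  "pathprob P mu [] = 1"
| "pathprob P mu [x] = P x (mu x) 0"
| "pathprob P mu (x # y # ys) = P x (mu x) y * pathprob P mu (y # ys)"

definition trajprob :: "nat \<Rightarrow> (nat \<Rightarrow> real) \<Rightarrow> (nat \<Rightarrow> 'a \<Rightarrow> nat \<Rightarrow> real) \<Rightarrow> (nat \<Rightarrow> 'a)
    \<Rightarrow> nat list \<Rightarrow> real" where
  "trajprob n p P mu tau =
     (if set tau \<subseteq> {1..n} then (case tau of [] \<Rightarrow> p 0 | x # _ \<Rightarrow> p x * pathprob P mu tau) else 0)"

definition trajs :: "nat \<Rightarrow> nat list set" where
  "trajs n = {tau. set tau \<subseteq> {1..n} \<and> distinct tau}"

definition visit_prob :: "nat \<Rightarrow> (nat \<Rightarrow> real) \<Rightarrow> (nat \<Rightarrow> 'a \<Rightarrow> nat \<Rightarrow> real) \<Rightarrow> (nat \<Rightarrow> 'a)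
    \<Rightarrow> nat \<Rightarrow> real" where
  "visit_prob n p P mu i = (\<Sum>tau\<in>{tau\<in>trajs n. i \<in> set tau}. trajprob n p P mu tau)"

definition pathcost :: "(nat \<Rightarrow> 'a \<Rightarrow> real) \<Rightarrow> (nat \<Rightarrow> 'a) \<Rightarrow> nat list \<Rightarrow> real" where
  "pathcost c mu tau = sum_list (map (\<lambda>x. c x (mu x)) tau)"

definition Jpol :: "nat \<Rightarrow> (nat \<Rightarrow> 'a \<Rightarrow> nat \<Rightarrow> real) \<Rightarrow> (nat \<Rightarrow> 'a \<Rightarrow> real) \<Rightarrow> (nat \<Rightarrow> 'a)
    \<Rightarrow> nat \<Rightarrow> real" where
  "Jpol n P c mu i = (\<Sum>tau\<in>{tau\<in>trajs n. tau \<noteq> [] \<and> hd tau = i}. pathprob P mu tau * pathcost c mu tau)"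

definition Jstar :: "nat \<Rightarrow> (nat \<Rightarrow> 'a set) \<Rightarrow> (nat \<Rightarrow> 'a \<Rightarrow> nat \<Rightarrow> real) \<Rightarrow> (nat \<Rightarrow> 'a \<Rightarrow> real)
    \<Rightarrow> nat \<Rightarrow> real" where
  "Jstar n A P c i = Min ((\<lambda>mu. Jpol n P c mu i) ` policies n A)"

definition tailcost :: "(nat \<Rightarrow> 'a \<Rightarrow> real) \<Rightarrow> (nat \<Rightarrow> 'a) \<Rightarrow> nat list \<Rightarrow> nat \<Rightarrow> real" where
  "tailcost c mu tau i = pathcost c mu (dropWhile (\<lambda>x. x \<noteq> i) tau)"

definition nvis :: "(nat \<Rightarrow> nat list) \<Rightarrow> nat \<Rightarrow> nat \<Rightarrow> nat" where
  "nvis xs t i = card {k. k < t \<and> i \<in> set (xs k)}"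

primrec Jseq :: "(nat list list \<Rightarrow> nat \<Rightarrow> 'a) \<Rightarrow> (nat \<Rightarrow> 'a \<Rightarrow> real)
    \<Rightarrow> ((nat \<Rightarrow> nat list) \<Rightarrow> nat \<Rightarrow> nat \<Rightarrow> real) \<Rightarrow> (nat \<Rightarrow> nat list) \<Rightarrow> nat \<Rightarrow> nat \<Rightarrow> real" where
  "Jseq mu c gam xs 0 = (\<lambda>i. 0)"
| "Jseq mu c gam xs (Suc t) = (\<lambda>i.
     if i \<in> set (xs t)
     then (1 - gam xs t i) * Jseq mu c gam xs t i
          + gam xs t i * tailcost c (mu (map xs [0..<t])) (xs t) i
     else Jseq mu c gam xs t i)"

text \<open>Q-value c(i,u) + sum_j P_ij(u) J(j), with J(0) = 0.\<close>
definition Qval :: "nat \<Rightarrow> (nat \<Rightarrow> 'a \<Rightarrow> nat \<Rightarrow> real) \<Rightarrow> (nat \<Rightarrow> 'a \<Rightarrow> real) \<Rightarrow> (nat \<Rightarrow> real)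
    \<Rightarrow> nat \<Rightarrow> 'a \<Rightarrow> real" where
  "Qval n P c J i u = c i u + (\<Sum>j\<in>{1..n}. P i u j * J j)"

definition reach_graph :: "nat \<Rightarrow> (nat \<Rightarrow> 'a set) \<Rightarrow> (nat \<Rightarrow> 'a \<Rightarrow> nat \<Rightarrow> real) \<Rightarrow> (nat \<times> nat) set" where
  "reach_graph n A P = {(i, j). i \<in> {1..n} \<and> j \<in> {1..n} \<and> (\<exists>u\<in>A i. P i u j > 0)}"

end

theory Submission
  imports Defs
begin

text \<open>The value of a state depends only on the values of its successors in the acyclic graph, so
  convergence is propagated backwards along the graph. If all successors of \<open>i\<close> have converged, then
  from some (random) time on the greedy policy is optimal at \<open>i\<close> and below, because there are only
  finitely many actions; from then on the simulated cost from \<open>i\<close> is an unbiased estimate of the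
  optimal value, and the recursion at \<open>i\<close> is a Robbins--Monro averaging scheme. Two almost sure facts
  are needed, both instances of the convergence of square-summable martingale difference series: the
  accumulated noise converges, and, since every policy visits \<open>i\<close> with probability bounded away from
  zero, the step sizes used at \<open>i\<close> have infinite sum. As there are finitely many trajectories, the
  martingale theory reduces to finite sums over histories.\<close>

section \<open>Robbins--Monro recursions\<close>

text \<open>Once the targets stay within \<open>\<epsilon> / 2\<close>, the excess of
  \<open>\<bar>y t\<bar>\<close> over that level shrinks by \<open>1 - a t\<close>, hence by at
  least \<open>exp (- a t)\<close>, at every step; divergence of the step sizes drives it to
  zero.\<close>

lemma averaging_recursion_tendsto_zero:
  fixes y a r :: "nat \<Rightarrow> real"
  assumes rec: "\<And>t. y (Suc t) = (1 - a t) * y t + a t * r t"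
    and a: "\<And>t. 0 \<le> a t" "\<And>t. a t \<le> 1"
    and r: "r \<longlonglongrightarrow> 0"
    and div: "filterlim (\<lambda>N. \<Sum>t<N. a t) at_top sequentially"
  shows "y \<longlonglongrightarrow> 0"
proof (rule LIMSEQ_I)
  fix \<epsilon> :: real assume "\<epsilon> > 0"
  then obtain T where T: "\<And>t. t \<ge> T \<Longrightarrow> \<bar>r t\<bar> < \<epsilon> / 2"
    using LIMSEQ_D[OF r, of "\<epsilon> / 2"] by auto
  define s where "s N = (\<Sum>t<N. a t)" for N
  \<comment> \<open>The sums \<open>s\<close> start at time 0, so the factor
    \<open>exp (s T)\<close> makes the envelope equal to \<open>\<bar>y T\<bar>\<close> at time
    \<open>T\<close>.\<close>
  define C where "C = \<bar>y T\<bar> * exp (s T)"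
  have bound: "\<bar>y t\<bar> \<le> \<epsilon> / 2 + C * exp (- s t)" if "t \<ge> T" for t
    using that
  proof (induction t rule: dec_induct)
    case base
    have "C * exp (- s T) = \<bar>y T\<bar>" by (simp add: C_def exp_minus)
    then show ?case using \<open>\<epsilon> > 0\<close> by simp
  next
    case (step t)
    have "\<bar>y (Suc t)\<bar> \<le> (1 - a t) * \<bar>y t\<bar> + a t * \<bar>r t\<bar>"
      unfolding rec using a[of t] by (intro order_trans[OF abs_triangle_ineq]) (simp add: abs_mult)
    also have "\<dots> \<le> (1 - a t) * (\<epsilon> / 2 + C * exp (- s t)) + a t * (\<epsilon> / 2)"
      using a[of t] step T[of t] by (intro add_mono mult_left_mono) auto
    also have "\<dots> = \<epsilon> / 2 + C * (exp (- s t) * (1 - a t))" by (simp add: field_simps)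
    also have "\<dots> \<le> \<epsilon> / 2 + C * (exp (- s t) * exp (- a t))"
      using exp_ge_add_one_self[of "- a t"] by (intro add_left_mono mult_left_mono) (auto simp: C_def)
    also have "exp (- s t) * exp (- a t) = exp (- s (Suc t))"
      by (simp add: s_def exp_add[symmetric])
    finally show ?case .
  qed
  have "(\<lambda>t. C * exp (- s t)) \<longlonglongrightarrow> C * 0"
    using div by (intro tendsto_mult tendsto_const filterlim_compose[OF exp_at_bot]
        filterlim_compose[OF filterlim_uminus_at_bot_at_top]) (simp add: s_def)
  then have "\<forall>\<^sub>F t in sequentially. C * exp (- s t) < \<epsilon> / 2"
    using \<open>\<epsilon> > 0\<close> by (intro order_tendstoD) auto
  moreover have "\<forall>\<^sub>F t in sequentially. t \<ge> T" by (rule eventually_ge_at_top)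
  ultimately have "\<forall>\<^sub>F t in sequentially. norm (y t - 0) < \<epsilon>"
    by eventually_elim (use bound in fastforce)
  then show "\<exists>N. \<forall>t\<ge>N. norm (y t - 0) < \<epsilon>" by (simp add: eventually_sequentially)
qed

text \<open>The target \<open>b\<close> moves with time because it will be the value of the current
  policy, which agrees with the optimum only eventually.\<close>

lemma robbins_monro_tendsto:
  fixes x a b e :: "nat \<Rightarrow> real"
  assumes rec: "\<And>t. x (Suc t) = (1 - a t) * x t + a t * b t + e t"
    and a: "\<And>t. 0 \<le> a t" "\<And>t. a t \<le> 1"
    and b: "b \<longlonglongrightarrow> l"
    and div: "filterlim (\<lambda>N. \<Sum>t<N. a t) at_top sequentially"
    and e: "convergent (\<lambda>N. \<Sum>t<N. e t)"
  shows "x \<longlonglongrightarrow> l"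
proof -
  obtain E where E: "(\<lambda>N. \<Sum>t<N. e t) \<longlonglongrightarrow> E" using e by (auto simp: convergent_def)
  \<comment> \<open>Adding the tail of the noise series to the iterate moves the noise into the averaged target.\<close>
  define R where "R t = E - (\<Sum>s<t. e s)" for t
  have R: "R \<longlonglongrightarrow> 0" unfolding R_def using tendsto_diff[OF tendsto_const E, of E] by simp
  have "(\<lambda>t. x t - l + R t) \<longlonglongrightarrow> 0"
  proof (rule averaging_recursion_tendsto_zero[OF _ a _ div, where r = "\<lambda>t. R t + (b t - l)"])
    show "x (Suc t) - l + R (Suc t) = (1 - a t) * (x t - l + R t) + a t * (R t + (b t - l))" for t
      by (simp add: rec R_def algebra_simps)
    show "(\<lambda>t. R t + (b t - l)) \<longlonglongrightarrow> 0"
      using tendsto_add[OF R tendsto_diff[OF b tendsto_const[of l]]] by simp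
  qed
  from tendsto_add[OF tendsto_diff[OF this R] tendsto_const[of l]] show ?thesis by simp
qed

lemma filterlim_sum_at_top_not_summable:
  fixes b :: "nat \<Rightarrow> real"
  assumes b: "\<And>k. b k \<ge> 0" "\<not> summable b"
  shows "filterlim (\<lambda>N. \<Sum>k<N. b k) at_top sequentially"
  unfolding filterlim_at_top
proof
  fix Z
  have "\<not> (\<forall>N. (\<Sum>k<N. b k) \<le> Z)"
    using summableI_nonneg_bounded[of b Z] b by blast
  then obtain N where N: "Z < (\<Sum>k<N. b k)" by (auto simp: not_le)
  have "Z \<le> (\<Sum>k<M. b k)" if "M \<ge> N" for M
    using N sum_mono2[of "{..<M}" "{..<N}" b] that b(1) by force
  then show "\<forall>\<^sub>F N in sequentially. Z \<le> (\<Sum>k<N. b k)"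
    unfolding eventually_sequentially by blast
qed

section \<open>Martingale differences over finite histories\<close>

definition hist :: "(nat \<Rightarrow> 'b) \<Rightarrow> nat \<Rightarrow> 'b list" where
  "hist xs t = map xs [0..<t]"

lemma length_hist [simp]: "length (hist xs t) = t"
  by (simp add: hist_def)

lemma hist_nth [simp]: "k < t \<Longrightarrow> hist xs t ! k = xs k"
  by (simp add: hist_def)

lemma hist_0 [simp]: "hist xs 0 = []"
  by (simp add: hist_def)

lemma hist_Suc [simp]: "hist xs (Suc t) = hist xs t @ [xs t]"
  by (simp add: hist_def)

lemma take_hist [simp]: "k \<le> t \<Longrightarrow> take k (hist xs t) = hist xs k"
  by (simp add: hist_def take_map)

lemma hist_eq_iff: "hist xs t = h \<longleftrightarrow> length h = t \<and> (\<forall>k<t. xs k = h ! k)"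
  by (metis hist_nth length_hist nth_equalityI)

text \<open>Adaptedness is expressed through cylinder probabilities alone: \<open>K h\<close> acts
  as the conditional law of the next letter after the word \<open>h\<close>. This replaces
  filtrations and conditional expectations.\<close>

locale history_process = prob_space M
  for M :: "'w measure" +
  fixes X :: "nat \<Rightarrow> 'w \<Rightarrow> 'b :: countable"
    and K :: "'b list \<Rightarrow> 'b \<Rightarrow> real"
    and T :: "'b set"
  assumes finite_T: "finite T"
    and X_measurable: "\<And>t. X t \<in> measurable M (count_space UNIV)"
    and K_support: "\<And>h x. x \<notin> T \<Longrightarrow> K h x = 0"
    and law: "\<And>h. prob {w\<in>space M. \<forall>k<length h. X k w = h ! k}
                 = (\<Prod>k<length h. K (take k h) (h ! k))"
begin

section \<open>Words of finite length and expectations as finite sums\<close>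

definition H :: "nat \<Rightarrow> 'w \<Rightarrow> 'b list" where
  "H t w = hist (\<lambda>k. X k w) t"

lemma H_simps [simp]: "H 0 w = []" "H (Suc t) w = H t w @ [X t w]" "length (H t w) = t"
  by (simp_all add: H_def)

lemma take_H [simp]: "k \<le> t \<Longrightarrow> take k (H t w) = H k w"
  by (simp add: H_def)

definition L :: "'b list \<Rightarrow> real" where
  "L h = (\<Prod>k<length h. K (take k h) (h ! k))"

lemma L_snoc: "L (h @ [x]) = L h * K h x"
  by (simp add: L_def nth_append)

definition B :: "nat \<Rightarrow> 'b list set" where
  "B t = {h. set h \<subseteq> T \<and> length h = t}"

lemma finite_B [simp]: "finite (B t)"
  unfolding B_def by (rule finite_lists_length_eq[OF finite_T])

lemma B_Suc: "B (Suc t) = (\<lambda>(h, x). h @ [x]) ` (B t \<times> T)"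
proof -
  have "h \<in> (\<lambda>(h, x). h @ [x]) ` (B t \<times> T)" if "h \<in> B (Suc t)" for h
    using that by (cases h rule: rev_cases) (auto simp: B_def)
  then show ?thesis by (auto simp: B_def)
qed

lemma sum_B_Suc:
  fixes F :: "'b list \<Rightarrow> real"
  shows "(\<Sum>h\<in>B (Suc t). F h) = (\<Sum>h\<in>B t. \<Sum>x\<in>T. F (h @ [x]))"
  unfolding B_Suc sum.cartesian_product
  by (subst sum.reindex) (auto intro!: inj_onI simp: case_prod_unfold)

lemma H_measurable [measurable]: "H t \<in> measurable M (count_space UNIV)"
proof -
  have "H t -` {h} \<inter> space M \<in> sets M" for h
  proof (cases "length h = t")
    case True
    then have "H t -` {h} \<inter> space M = {w\<in>space M. \<forall>k<t. X k w = h ! k}"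
      by (auto simp: H_def hist_eq_iff)
    also have "\<dots> \<in> sets M"
      using X_measurable by measurable
    finally show ?thesis .
  next
    case False
    then have "H t -` {h} \<inter> space M = {}" by (auto simp: H_def hist_eq_iff)
    then show ?thesis by simp
  qed
  then show ?thesis
    by (subst measurable_count_space_eq2_countable) (auto intro: countableI_type)
qed

lemma prob_H: "prob {w\<in>space M. H (length h) w = h} = L h"
  using law[of h] by (simp add: H_def hist_eq_iff L_def)

text \<open>A word with a letter outside \<open>T\<close> has a vanishing factor in its probability,
  and there are only countably many words.\<close>

lemma AE_H_in_B: "AE w in M. H t w \<in> B t"
proof -
  have "AE w in M. H t w \<noteq> h" if h: "h \<notin> B t" for h
  proof (cases "length h = t")
    case True
    then obtain k where "k < length h" "h ! k \<notin> T"
      using h by (force simp: B_def in_set_conv_nth)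
    then have "L h = 0"
      unfolding L_def using K_support by (subst prod_zero_iff) auto
    then have "prob {w\<in>space M. H t w = h} = 0" using prob_H[of h] True by simp
    moreover have "{w\<in>space M. H t w = h} \<in> sets M" by measurable
    ultimately have "AE w in M. w \<notin> {w\<in>space M. H t w = h}"
      by (intro AE_not_in null_setsI) (simp_all add: emeasure_eq_measure)
    then show ?thesis using AE_space by eventually_elim auto
  next
    case False
    then show ?thesis by auto
  qed
  then have "AE w in M. \<forall>h\<in>- B t. H t w \<noteq> h"
    by (subst AE_ball_countable) (auto intro: countableI_type)
  then show ?thesis by eventually_elim auto
qed

lemma AE_X_in_T: "AE w in M. \<forall>t. X t w \<in> T"
proof -
  have "AE w in M. X t w \<in> T" for t
    using AE_H_in_B[of "Suc t"] by eventually_elim (simp add: B_def)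
  then show ?thesis by (simp add: AE_all_countable)
qed

text \<open>Almost surely \<open>H t\<close> takes finitely many values, so \<open>F (H t w)\<close>
  is a finite combination of indicators; integrability is automatic.\<close>

lemma
  fixes F :: "'b list \<Rightarrow> real"
  shows integrable_H: "integrable M (\<lambda>w. F (H t w))"
    and expectation_H: "expectation (\<lambda>w. F (H t w)) = (\<Sum>h\<in>B t. L h * F h)"
proof -
  let ?I = "\<lambda>h w. indicator {w\<in>space M. H t w = h} w * F h"
  have ae: "AE w in M. (\<Sum>h\<in>B t. ?I h w) = F (H t w)"
    using AE_H_in_B[of t] AE_space
  proof eventually_elim
    case (elim w)
    have "(\<Sum>h\<in>B t. ?I h w) = (\<Sum>h\<in>B t. if h = H t w then F h else 0)"
      using elim by (intro sum.cong) (auto simp: indicator_def)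
    then show ?case using elim by simp
  qed
  have meas: "(\<lambda>w. F (H t w)) \<in> borel_measurable M" by measurable
  have ev: "{w\<in>space M. H t w = h} \<in> sets M" for h by measurable
  have int: "integrable M (?I h)" for h
    using ev[of h] by (intro integrable_mult_left integrable_real_indicator) (auto simp: emeasure_eq_measure)
  then have "integrable M (\<lambda>w. \<Sum>h\<in>B t. ?I h w)" by (intro Bochner_Integration.integrable_sum)
  then show "integrable M (\<lambda>w. F (H t w))"
    by (rule integrable_cong_AE_imp[OF _ meas ae])
  have "expectation (\<lambda>w. F (H t w)) = expectation (\<lambda>w. \<Sum>h\<in>B t. ?I h w)"
    using ae meas ev by (intro integral_cong_AE) auto
  also have "\<dots> = (\<Sum>h\<in>B t. expectation (?I h))"
    using int by (intro Bochner_Integration.integral_sum) auto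
  also have "\<dots> = (\<Sum>h\<in>B t. L h * F h)"
    using prob_H ev by (intro sum.cong) (auto simp: B_def Int_def conj_commute)
  finally show "expectation (\<lambda>w. F (H t w)) = (\<Sum>h\<in>B t. L h * F h)" .
qed

text \<open>An adapted process is given by its increments: \<open>f h x\<close> is added when \<open>x\<close> follows the history
  \<open>h\<close>, and \<open>K h\<close> is the conditional law of \<open>x\<close>.\<close>

definition mds :: "('b list \<Rightarrow> 'b \<Rightarrow> real) \<Rightarrow> bool" where
  "mds f \<longleftrightarrow> (\<forall>h. set h \<subseteq> T \<longrightarrow> (\<Sum>x\<in>T. K h x * f h x) = 0)"

definition psum :: "('b list \<Rightarrow> 'b \<Rightarrow> real) \<Rightarrow> 'b list \<Rightarrow> real" where
  "psum f h = (\<Sum>k<length h. f (take k h) (h ! k))"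

lemma psum_simps [simp]: "psum f [] = 0" "psum f (h @ [x]) = psum f h + f h x"
  by (simp_all add: psum_def nth_append)

lemma psum_H: "psum f (H t w) = (\<Sum>k<t. f (H k w) (X k w))"
  by (induction t) auto

definition msq :: "('b list \<Rightarrow> 'b \<Rightarrow> real) \<Rightarrow> nat \<Rightarrow> real" where
  "msq f k = expectation (\<lambda>w. (f (H k w) (X k w))\<^sup>2)"

text \<open>The pair of history and next letter is recovered from a word of length
  \<open>Suc k\<close> by \<open>butlast\<close> and \<open>last\<close>.\<close>

lemma
  fixes f :: "'b list \<Rightarrow> 'b \<Rightarrow> real"
  shows integrable_sq: "integrable M (\<lambda>w. (f (H k w) (X k w))\<^sup>2)"
    and msq_eq: "msq f k = (\<Sum>h\<in>B k. \<Sum>x\<in>T. L h * K h x * (f h x)\<^sup>2)"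
  using integrable_H[of "\<lambda>h. (f (butlast h) (last h))\<^sup>2" "Suc k"]
    expectation_H[of "\<lambda>h. (f (butlast h) (last h))\<^sup>2" "Suc k"]
  by (simp_all add: msq_def sum_B_Suc L_snoc)

lemma msq_nonneg: "msq f k \<ge> 0"
  unfolding msq_def by simp

text \<open>Orthogonality of martingale differences: given the history, the cross term in the
  expanded square has mean zero.\<close>

lemma expectation_psum_sq:
  assumes "mds f"
  shows "expectation (\<lambda>w. (psum f (H t w))\<^sup>2) = (\<Sum>k<t. msq f k)"
proof (induction t)
  case 0
  then show ?case by simp
next
  case (Suc t)
  have "(\<Sum>x\<in>T. L h * K h x * (psum f h + f h x)\<^sup>2)
      = L h * (psum f h)\<^sup>2 * (\<Sum>x\<in>T. K h x) + (\<Sum>x\<in>T. L h * K h x * (f h x)\<^sup>2)"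
    if "h \<in> B t" for h
  proof -
    have "(\<Sum>x\<in>T. L h * K h x * (psum f h + f h x)\<^sup>2)
      = L h * (psum f h)\<^sup>2 * (\<Sum>x\<in>T. K h x) + (\<Sum>x\<in>T. L h * K h x * (f h x)\<^sup>2)
        + 2 * L h * psum f h * (\<Sum>x\<in>T. K h x * f h x)"
      by (simp add: sum_distrib_left sum_distrib_right sum.distrib power2_sum algebra_simps)
    moreover have "(\<Sum>x\<in>T. K h x * f h x) = 0" using assms that by (auto simp: mds_def B_def)
    ultimately show ?thesis by simp
  qed
  then have "expectation (\<lambda>w. (psum f (H (Suc t) w))\<^sup>2)
    = (\<Sum>h\<in>B t. L h * (psum f h)\<^sup>2 * (\<Sum>x\<in>T. K h x)) + msq f t"
    by (subst expectation_H) (simp add: sum_B_Suc L_snoc msq_eq sum.distrib)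
  \<comment> \<open>The factor \<open>\<Sum>x\<in>T. K h x\<close> is absorbed rather than
    evaluated: the sum is the expectation of a function of \<open>H t w\<close> computed over words
    of length \<open>Suc t\<close>.\<close>
  also have "(\<Sum>h\<in>B t. L h * (psum f h)\<^sup>2 * (\<Sum>x\<in>T. K h x)) = expectation (\<lambda>w. (psum f (H t w))\<^sup>2)"
    using expectation_H[of "\<lambda>h. (psum f (butlast h))\<^sup>2" "Suc t"]
    by (simp add: sum_B_Suc L_snoc sum_distrib_left sum_distrib_right mult_ac)
  finally show ?case using Suc by simp
qed

text \<open>Kolmogorov's inequality: the increments are switched off once the threshold is reached, so
  that the stopped sum is still large at the final time.\<close>

lemma maximal_inequality:
  assumes f: "mds f" and \<epsilon>: "\<epsilon> > 0"
  shows "prob {w\<in>space M. \<exists>k\<in>{m..m+N}. \<bar>psum f (H k w) - psum f (H m w)\<bar> \<ge> \<epsilon>}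
           \<le> (\<Sum>k\<in>{m..<m+N}. msq f k) / \<epsilon>\<^sup>2"
proof -
  \<comment> \<open>Requiring \<open>m \<le> length h\<close> removes all increments before time
    \<open>m\<close>, so the stopped sum starts from zero at time \<open>m\<close>.\<close>
  define ok where "ok h \<longleftrightarrow> m \<le> length h \<and>
    (\<forall>k\<in>{m..length h}. \<bar>psum f (take k h) - psum f (take m h)\<bar> < \<epsilon>)" for h
  define g where "g h x = (if ok h then f h x else 0)" for h x
  \<comment> \<open>Whether an increment is kept is decided by the history alone, so its conditional
    mean stays zero.\<close>
  have g: "mds g"
    unfolding mds_def g_def
  proof (intro allI impI)
    fix h assume "set h \<subseteq> T"
    then show "(\<Sum>x\<in>T. K h x * (if ok h then f h x else 0)) = 0"
      using f by (cases "ok h") (simp_all add: mds_def)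
  qed
  have psum0: "psum g (H k w) = 0" if "k \<le> m" for k w
    using that unfolding psum_H by (intro sum.neutral) (auto simp: g_def ok_def)
  have stopped: "(\<forall>j\<in>{m..k}. \<bar>psum f (H j w) - psum f (H m w)\<bar> < \<epsilon>) \<and>
           psum g (H k w) = psum f (H k w) - psum f (H m w) \<or>
         (\<exists>j\<in>{m..k}. \<bar>psum f (H j w) - psum f (H m w)\<bar> \<ge> \<epsilon>) \<and> \<bar>psum g (H k w)\<bar> \<ge> \<epsilon>"
    if "k \<ge> m" for k w
    using that
  proof (induction k rule: dec_induct)
    case base
    then show ?case using psum0 \<epsilon> by simp
  next
    case (step k)
    have ok: "ok (H k w) \<longleftrightarrow> (\<forall>j\<in>{m..k}. \<bar>psum f (H j w) - psum f (H m w)\<bar> < \<epsilon>)"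
      using step.hyps by (auto simp: ok_def)
    have iv: "{m..Suc k} = insert (Suc k) {m..k}" using step.hyps by auto
    show ?case
    proof (cases "ok (H k w)")
      case True
      then have *: "\<forall>j\<in>{m..k}. \<bar>psum f (H j w) - psum f (H m w)\<bar> < \<epsilon>" using ok by simp
      then have "\<not> (\<exists>j\<in>{m..k}. \<bar>psum f (H j w) - psum f (H m w)\<bar> \<ge> \<epsilon>)" by fastforce
      then have "psum g (H k w) = psum f (H k w) - psum f (H m w)" using step.IH by blast
      then have "psum g (H (Suc k) w) = psum f (H (Suc k) w) - psum f (H m w)"
        using True by (simp add: g_def)
      then show ?thesis unfolding iv using * by (auto simp del: H_simps)
    next
      case False
      then have "(\<exists>j\<in>{m..k}. \<bar>psum f (H j w) - psum f (H m w)\<bar> \<ge> \<epsilon>) \<and> \<bar>psum g (H k w)\<bar> \<ge> \<epsilon>"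
        using ok step.IH by blast
      moreover have "psum g (H (Suc k) w) = psum g (H k w)" using False by (simp add: g_def)
      ultimately show ?thesis unfolding iv by (auto simp del: H_simps)
    qed
  qed
  let ?A = "{w\<in>space M. \<exists>k\<in>{m..m+N}. \<bar>psum f (H k w) - psum f (H m w)\<bar> \<ge> \<epsilon>}"
  let ?G = "{w\<in>space M. (psum g (H (m+N) w))\<^sup>2 \<ge> \<epsilon>\<^sup>2}"
  have "w \<in> ?G" if "w \<in> ?A" for w
  proof -
    have "\<not> (\<forall>j\<in>{m..m+N}. \<bar>psum f (H j w) - psum f (H m w)\<bar> < \<epsilon>)"
      using that by (force simp: not_less)
    then have "\<bar>psum g (H (m+N) w)\<bar> \<ge> \<epsilon>" using stopped[of "m+N" w] by auto
    then show ?thesis using that \<epsilon> by (auto intro: abs_le_square_iff[THEN iffD1] simp: power2_le_iff_abs_le)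
  qed
  then have "prob ?A \<le> prob ?G" by (intro finite_measure_mono) auto
  also have "\<dots> \<le> expectation (\<lambda>w. (psum g (H (m+N) w))\<^sup>2) / \<epsilon>\<^sup>2"
    using \<epsilon> by (intro integral_Markov_inequality_measure[where A = "{}"] integrable_H) auto
  also have "expectation (\<lambda>w. (psum g (H (m+N) w))\<^sup>2) = (\<Sum>k<m+N. msq g k)"
    by (rule expectation_psum_sq[OF g])
  also have "\<dots> = (\<Sum>k\<in>{m..<m+N}. msq g k)"
    by (intro sum.mono_neutral_right) (auto simp: msq_def g_def ok_def)
  also have "\<dots> \<le> (\<Sum>k\<in>{m..<m+N}. msq f k)"
    unfolding msq_def by (intro sum_mono integral_mono integrable_sq) (auto simp: g_def)
  finally show ?thesis using \<epsilon> by (simp add: divide_right_mono)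
qed

text \<open>The bound \<open>C\<close> makes the variances of the increments summable. By the
  maximal inequality the oscillation after time \<open>m\<close> is then small with high
  probability, which yields the Cauchy property almost surely.\<close>

theorem AE_convergent_psum:
  assumes f: "mds f" and bound: "\<And>N. AE w in M. (\<Sum>k<N. (f (H k w) (X k w))\<^sup>2) \<le> C"
  shows "AE w in M. convergent (\<lambda>t. \<Sum>k<t. f (H k w) (X k w))"
proof -
  have "(\<Sum>k<N. msq f k) \<le> C" for N
  proof -
    have "(\<Sum>k<N. msq f k) = expectation (\<lambda>w. \<Sum>k<N. (f (H k w) (X k w))\<^sup>2)"
      unfolding msq_def by (subst Bochner_Integration.integral_sum) (auto intro: integrable_sq)
    also have "\<dots> \<le> C"
      using bound by (intro integral_le_const Bochner_Integration.integrable_sum integrable_sq)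
    finally show ?thesis .
  qed
  then have summable: "summable (msq f)"
    by (intro summableI_nonneg_bounded[where x = C] msq_nonneg)
  define tail where "tail m = (\<Sum>k. msq f (k + m))" for m
  have tail: "tail \<longlonglongrightarrow> 0"
    unfolding tail_def using summable by (rule suminf_exist_split2)
  let ?D = "\<lambda>k m w. \<bar>psum f (H k w) - psum f (H m w)\<bar>"
  have osc: "AE w in M. \<exists>m. \<forall>k\<ge>m. ?D k m w < \<epsilon>" if \<epsilon>: "\<epsilon> > 0" for \<epsilon>
  proof -
    \<comment> \<open>The maximal inequality on a window of length \<open>N\<close> has a bound
      independent of \<open>N\<close>; continuity from below removes the window.\<close>
    have le: "prob {w\<in>space M. \<exists>k\<ge>m. ?D k m w \<ge> \<epsilon>} \<le> tail m / \<epsilon>\<^sup>2" for m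
    proof (rule LIMSEQ_le_const2)
      let ?S = "\<lambda>N. {w\<in>space M. \<exists>k\<in>{m..m+N}. ?D k m w \<ge> \<epsilon>}"
      have "(\<lambda>N. prob (?S N)) \<longlonglongrightarrow> prob (\<Union>N. ?S N)"
      proof (rule finite_Lim_measure_incseq)
        have "?S N \<in> sets M" for N by measurable
        then show "range ?S \<subseteq> sets M" by auto
        show "incseq ?S" by (fastforce simp: incseq_def)
      qed
      also have "(\<Union>N. ?S N) = {w\<in>space M. \<exists>k\<ge>m. ?D k m w \<ge> \<epsilon>}"
      proof (intro set_eqI iffI)
        fix w assume "w \<in> {w\<in>space M. \<exists>k\<ge>m. ?D k m w \<ge> \<epsilon>}"
        then obtain k where k: "w \<in> space M" "k \<ge> m" "?D k m w \<ge> \<epsilon>" by blast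
        then have "w \<in> ?S (k - m)" by (auto intro!: bexI[of _ k])
        then show "w \<in> (\<Union>N. ?S N)" by blast
      qed auto
      finally show "(\<lambda>N. prob (?S N)) \<longlonglongrightarrow> prob {w\<in>space M. \<exists>k\<ge>m. ?D k m w \<ge> \<epsilon>}" .
      have "prob (?S N) \<le> tail m / \<epsilon>\<^sup>2" for N
      proof -
        have "(\<Sum>k\<in>{m..<m+N}. msq f k) = (\<Sum>k<N. msq f (k + m))"
          by (rule sum.reindex_bij_witness[of _ "\<lambda>k. k + m" "\<lambda>k. k - m"]) auto
        also have "\<dots> \<le> tail m"
          unfolding tail_def using summable msq_nonneg
          by (intro sum_le_suminf) (auto simp: summable_iff_shift)
        finally show ?thesis
          using maximal_inequality[OF f \<epsilon>, of m N] by (meson divide_right_mono order_trans zero_le_power2)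
      qed
      then show "\<exists>N. \<forall>n\<ge>N. prob (?S n) \<le> tail m / \<epsilon>\<^sup>2" by blast
    qed
    \<comment> \<open>Failure for every \<open>m\<close> lies inside the failure event for each
      single \<open>m\<close>, so its probability is below all the vanishing tails.\<close>
    let ?Z = "{w\<in>space M. \<forall>m. \<exists>k\<ge>m. ?D k m w \<ge> \<epsilon>}"
    have Z: "?Z \<in> sets M" by measurable
    have "prob ?Z \<le> tail m / \<epsilon>\<^sup>2" for m
      by (rule order_trans[OF finite_measure_mono le]) auto
    moreover have "(\<lambda>m. tail m / \<epsilon>\<^sup>2) \<longlonglongrightarrow> 0 / \<epsilon>\<^sup>2"
      using tail \<epsilon> by (intro tendsto_divide) auto
    ultimately have "prob ?Z \<le> 0" by (intro LIMSEQ_le_const[of _ "0"]) auto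
    then have "AE w in M. w \<notin> ?Z"
      using Z by (intro AE_not_in null_setsI) (auto simp: emeasure_eq_measure measure_le_0_iff)
    then show ?thesis using AE_space by eventually_elim (simp, meson not_le)
  qed
  \<comment> \<open>Thresholds \<open>1 / Suc r\<close> suffice for the Cauchy property and leave
    only countably many null sets.\<close>
  have "AE w in M. \<forall>r::nat. \<exists>m. \<forall>k\<ge>m. ?D k m w < 1 / Suc r"
    using osc by (subst AE_all_countable) auto
  then show ?thesis
  proof eventually_elim
    case (elim w)
    have "Cauchy (\<lambda>t. psum f (H t w))"
    proof (rule metric_CauchyI)
      fix e :: real assume "e > 0"
      then obtain r where r: "1 / Suc r < e / 2" using nat_approx_posE[of "e/2"] by auto
      from elim obtain m where m: "\<And>k. k \<ge> m \<Longrightarrow> ?D k m w < 1 / Suc r" by blast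
      have "dist (psum f (H k w)) (psum f (H l w)) < e" if "k \<ge> m" "l \<ge> m" for k l
        using m[OF that(1)] m[OF that(2)] r unfolding dist_real_def by linarith
      then show "\<exists>m. \<forall>k\<ge>m. \<forall>l\<ge>m. dist (psum f (H k w)) (psum f (H l w)) < e" by blast
    qed
    then show ?case by (simp add: Cauchy_convergent_iff psum_H)
  qed
qed

end

section \<open>Acyclic shortest path problems\<close>

lemma pathprob_cong:
  "(\<And>x. x \<in> set tau \<Longrightarrow> mu x = mu' x) \<Longrightarrow> pathprob P mu tau = pathprob P mu' tau"
  by (induction P mu tau rule: pathprob.induct) auto

lemma pathcost_cong:
  "(\<And>x. x \<in> set tau \<Longrightarrow> mu x = mu' x) \<Longrightarrow> pathcost c mu tau = pathcost c mu' tau"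
  unfolding pathcost_def by (auto cong: map_cong)

lemma pathcost_Cons [simp]: "pathcost c mu (x # tau) = c x (mu x) + pathcost c mu tau"
  by (simp add: pathcost_def)

lemma pathcost_Nil [simp]: "pathcost c mu [] = 0"
  by (simp add: pathcost_def)

lemma finite_trajs [simp]: "finite (trajs n)"
  unfolding trajs_def by (intro finite_subset_distinct) simp

lemma Jpol_cong:
  assumes "\<And>x. x \<in> {1..n} \<Longrightarrow> mu x = mu' x"
  shows "Jpol n P c mu i = Jpol n P c mu' i"
  unfolding Jpol_def
proof (rule sum.cong[OF refl])
  fix tau assume "tau \<in> {tau \<in> trajs n. tau \<noteq> [] \<and> hd tau = i}"
  then have "\<And>x. x \<in> set tau \<Longrightarrow> mu x = mu' x" using assms by (auto simp: trajs_def)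
  then show "pathprob P mu tau * pathcost c mu tau = pathprob P mu' tau * pathcost c mu' tau"
    using pathprob_cong[of tau mu mu' P] pathcost_cong[of tau mu mu' c] by simp
qed

lemma visit_prob_cong:
  assumes "\<And>x. x \<in> {1..n} \<Longrightarrow> mu x = mu' x"
  shows "visit_prob n p P mu i = visit_prob n p P mu' i"
  unfolding visit_prob_def
proof (rule sum.cong[OF refl])
  fix tau assume "tau \<in> {tau \<in> trajs n. i \<in> set tau}"
  then have "\<And>x. x \<in> set tau \<Longrightarrow> mu x = mu' x" using assms by (auto simp: trajs_def)
  then show "trajprob n p P mu tau = trajprob n p P mu' tau"
    using pathprob_cong[of tau mu mu' P] by (cases tau) (auto simp: trajprob_def)
qed

section \<open>Weights of path segments\<close>

text \<open>Weight of a segment leading into \<open>i\<close>. Unlike \<open>pathprob\<close> it has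
  no final jump to 0, so a path can be cut at \<open>i\<close>; \<open>hd (xs @ [i])\<close> is the
  state entered next.\<close>

primrec edgeprob :: "(nat \<Rightarrow> 'a \<Rightarrow> nat \<Rightarrow> real) \<Rightarrow> (nat \<Rightarrow> 'a) \<Rightarrow> nat list \<Rightarrow> nat \<Rightarrow> real" where
  "edgeprob P mu [] i = 1"
| "edgeprob P mu (x # xs) i = P x (mu x) (hd (xs @ [i])) * edgeprob P mu xs i"

lemma pathprob_append:
  "pathprob P mu (rho @ i # sig) = edgeprob P mu rho i * pathprob P mu (i # sig)"
proof (induction rho)
  case Nil
  then show ?case by simp
next
  case (Cons x rho)
  then show ?case by (cases rho) auto
qed

locale ssp =
  fixes n :: nat
    and A :: "nat \<Rightarrow> 'a set"
    and P :: "nat \<Rightarrow> 'a \<Rightarrow> nat \<Rightarrow> real"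
    and c :: "nat \<Rightarrow> 'a \<Rightarrow> real"
    and p :: "nat \<Rightarrow> real"
  assumes A_fin: "\<And>i. i \<in> {0..n} \<Longrightarrow> finite (A i) \<and> A i \<noteq> {}"
    and P_nonneg: "\<And>i u j. i \<in> {0..n} \<Longrightarrow> u \<in> A i \<Longrightarrow> P i u j \<ge> 0"
    and P_sum: "\<And>i u. i \<in> {0..n} \<Longrightarrow> u \<in> A i \<Longrightarrow> (\<Sum>j\<in>{0..n}. P i u j) = 1"
    and c_nonneg: "\<And>i u. i \<in> {0..n} \<Longrightarrow> u \<in> A i \<Longrightarrow> c i u \<ge> 0"
    and p_nonneg: "\<And>j. p j \<ge> 0"
    and p_sum: "(\<Sum>j\<in>{0..n}. p j) = 1"
    and acyclic_reach: "acyclic (reach_graph n A P)"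
begin

abbreviation "S \<equiv> {1..n}"
abbreviation "G \<equiv> reach_graph n A P"
abbreviation "chain \<equiv> successively (\<lambda>x y. (x, y) \<in> G)"

lemma G_subset: "G \<subseteq> S \<times> S"
  by (auto simp: reach_graph_def)

text \<open>A finite acyclic graph admits induction from successors to predecessors; the inductions
  on states below and the recursion defining \<open>V\<close> rest on it.\<close>

lemma wf_G: "wf (G\<inverse>)"
  using acyclic_reach G_subset
  by (intro finite_acyclic_wf_converse) (auto intro: finite_subset)

lemma policy_action: "mu \<in> policies n A \<Longrightarrow> i \<in> S \<Longrightarrow> mu i \<in> A i"
  by (simp add: policies_def)

lemma P_eq_0:
  assumes "i \<in> S" "j \<in> S" "u \<in> A i" "(i, j) \<notin> G"
  shows "P i u j = 0"
proof -
  have "\<not> P i u j > 0" using assms by (auto simp: reach_graph_def)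
  then show ?thesis using P_nonneg[of i u j] assms by auto
qed

lemma policy_P_nonneg: "mu \<in> policies n A \<Longrightarrow> i \<in> S \<Longrightarrow> P i (mu i) j \<ge> 0"
  using P_nonneg[of i "mu i" j] policy_action[of mu i] by simp

lemma policy_P_eq_0:
  "mu \<in> policies n A \<Longrightarrow> i \<in> S \<Longrightarrow> j \<in> S \<Longrightarrow> (i, j) \<notin> G \<Longrightarrow> P i (mu i) j = 0"
  using P_eq_0 policy_action by simp

lemma P_sum_split: "i \<in> S \<Longrightarrow> u \<in> A i \<Longrightarrow> P i u 0 + (\<Sum>j\<in>S. P i u j) = 1"
  using P_sum[of i u] by (simp add: sum.atLeast_Suc_atMost)

lemma p_sum_split: "p 0 + (\<Sum>j\<in>S. p j) = 1"
  using p_sum by (simp add: sum.atLeast_Suc_atMost)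

text \<open>Each state of a chain reaches every later one along \<open>G\<close>, so a repetition
  would close a cycle.\<close>

lemma chain_distinct:
  assumes "chain tau"
  shows "distinct tau"
proof -
  have "successively (\<lambda>x y. (x, y) \<in> G\<^sup>+) tau"
    by (rule successively_mono[OF assms]) auto
  then have "sorted_wrt (\<lambda>x y. (x, y) \<in> G\<^sup>+) tau"
    by (subst (asm) successively_conv_sorted_wrt) (auto intro: transpI trancl_trans)
  then show ?thesis
  proof (induction tau)
    case (Cons x tau)
    then have "x \<notin> set tau" using acyclic_reach unfolding acyclic_def by fastforce
    with Cons show ?case by simp
  qed simp
qed

lemma pathprob_nonneg:
  "mu \<in> policies n A \<Longrightarrow> set tau \<subseteq> S \<Longrightarrow> pathprob P mu tau \<ge> 0"
  by (induction tau rule: induct_list012) (auto simp: policy_P_nonneg)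

lemma pathprob_not_chain:
  "mu \<in> policies n A \<Longrightarrow> set tau \<subseteq> S \<Longrightarrow> \<not> chain tau \<Longrightarrow> pathprob P mu tau = 0"
  by (induction tau rule: induct_list012) (auto simp: policy_P_eq_0)

lemma trajprob_nonneg: "mu \<in> policies n A \<Longrightarrow> trajprob n p P mu tau \<ge> 0"
  using pathprob_nonneg[of mu tau] p_nonneg by (cases tau) (auto simp: trajprob_def)

lemma trajprob_not_chain:
  "mu \<in> policies n A \<Longrightarrow> \<not> chain tau \<Longrightarrow> trajprob n p P mu tau = 0"
  using pathprob_not_chain[of mu tau] by (cases tau) (auto simp: trajprob_def)

text \<open>Supplies the finite support that \<open>history_process\<close> demands: a list with a
  repeated state must use a transition of probability zero.\<close>

lemma trajprob_not_traj:
  assumes "mu \<in> policies n A" "tau \<notin> trajs n"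
  shows "trajprob n p P mu tau = 0"
proof (cases "set tau \<subseteq> S")
  case True
  then have "\<not> chain tau" using assms chain_distinct by (auto simp: trajs_def)
  then show ?thesis using assms trajprob_not_chain by simp
qed (auto simp: trajprob_def)

section \<open>Paths from a state and the Bellman equation of a policy\<close>

text \<open>Passing from distinct lists to chains loses only lists of weight zero. Chains stay
  chains when a predecessor is prepended, whereas distinctness alone could be lost.\<close>

definition paths :: "nat \<Rightarrow> nat list set" where
  "paths i = {tau. tau \<noteq> [] \<and> hd tau = i \<and> set tau \<subseteq> S \<and> chain tau}"

lemma paths_subset_trajs: "paths i \<subseteq> trajs n"
  using chain_distinct by (auto simp: paths_def trajs_def)

lemma paths_not_Nil: "tau \<in> paths i \<Longrightarrow> tau \<noteq> []"
  by (simp add: paths_def)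

lemma paths_hd: "tau \<in> paths i \<Longrightarrow> hd tau = i"
  by (simp add: paths_def)

lemma finite_paths [simp]: "finite (paths i)"
  by (rule finite_subset[OF paths_subset_trajs]) simp

lemma sum_trajs_from:
  assumes "mu \<in> policies n A"
  shows "(\<Sum>tau\<in>{tau\<in>trajs n. tau \<noteq> [] \<and> hd tau = i}. pathprob P mu tau * F tau)
       = (\<Sum>tau\<in>paths i. pathprob P mu tau * F tau)"
proof (rule sum.mono_neutral_right)
  show "paths i \<subseteq> {tau \<in> trajs n. tau \<noteq> [] \<and> hd tau = i}"
    using paths_subset_trajs by (auto simp: paths_def)
  show "\<forall>tau\<in>{tau \<in> trajs n. tau \<noteq> [] \<and> hd tau = i} - paths i. pathprob P mu tau * F tau = 0"
    using pathprob_not_chain[OF assms] by (auto simp: paths_def trajs_def)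
qed simp

lemma Jpol_eq_sum_paths:
  "mu \<in> policies n A \<Longrightarrow>
    Jpol n P c mu i = (\<Sum>tau\<in>paths i. pathprob P mu tau * pathcost c mu tau)"
  unfolding Jpol_def by (rule sum_trajs_from)

lemma paths_rec:
  assumes "i \<in> S"
  shows "paths i = insert [i] (\<Union>j\<in>{j. (i, j) \<in> G}. (#) i ` paths j)"
proof (intro set_eqI iffI)
  fix tau assume tau: "tau \<in> paths i"
  then obtain sig where sig: "tau = i # sig" by (cases tau) (auto simp: paths_def)
  show "tau \<in> insert [i] (\<Union>j\<in>{j. (i, j) \<in> G}. (#) i ` paths j)"
  proof (cases "sig = []")
    case False
    then have "(i, hd sig) \<in> G" "sig \<in> paths (hd sig)"
      using tau by (auto simp: sig paths_def successively_Cons)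
    then show ?thesis using sig by blast
  qed (simp add: sig)
next
  fix tau assume "tau \<in> insert [i] (\<Union>j\<in>{j. (i, j) \<in> G}. (#) i ` paths j)"
  then show "tau \<in> paths i"
    using assms by (auto simp: paths_def successively_Cons)
qed

text \<open>First-step analysis: from \<open>i\<close> the process is absorbed at once, which is the
  path \<open>[i]\<close>, or continues as a path from a successor.\<close>

lemma sum_paths:
  assumes mu: "mu \<in> policies n A" and i: "i \<in> S"
  shows "(\<Sum>tau\<in>paths i. pathprob P mu tau * F tau)
       = P i (mu i) 0 * F [i] + (\<Sum>j\<in>S. P i (mu i) j * (\<Sum>sig\<in>paths j. pathprob P mu sig * F (i # sig)))"
proof -
  let ?g = "\<lambda>tau. pathprob P mu tau * F tau"
  let ?N = "{j. (i, j) \<in> G}"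
  have N: "?N \<subseteq> S" using G_subset by auto
  then have finN: "finite ?N" by (rule finite_subset) simp
  have "(\<Sum>tau\<in>paths i. ?g tau) = ?g [i] + (\<Sum>tau\<in>(\<Union>j\<in>?N. (#) i ` paths j). ?g tau)"
    unfolding paths_rec[OF i] using finN by (subst sum.insert) (auto dest: paths_not_Nil)
  also have "(\<Sum>tau\<in>(\<Union>j\<in>?N. (#) i ` paths j). ?g tau) = (\<Sum>j\<in>?N. \<Sum>tau\<in>(#) i ` paths j. ?g tau)"
    using finN by (intro sum.UNION_disjoint) (auto dest: paths_hd)
  also have "\<dots> = (\<Sum>j\<in>?N. \<Sum>sig\<in>paths j. ?g (i # sig))"
    by (rule sum.cong[OF refl]) (subst sum.reindex, auto)
  also have "\<dots> = (\<Sum>j\<in>?N. P i (mu i) j * (\<Sum>sig\<in>paths j. pathprob P mu sig * F (i # sig)))"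
  proof (intro sum.cong refl)
    fix j
    have "pathprob P mu (i # sig) = P i (mu i) j * pathprob P mu sig" if "sig \<in> paths j" for sig
      using that by (cases sig) (auto simp: paths_def)
    then show "(\<Sum>sig\<in>paths j. ?g (i # sig))
        = P i (mu i) j * (\<Sum>sig\<in>paths j. pathprob P mu sig * F (i # sig))"
      by (simp add: sum_distrib_left mult.assoc)
  qed
  also have "\<dots> = (\<Sum>j\<in>S. P i (mu i) j * (\<Sum>sig\<in>paths j. pathprob P mu sig * F (i # sig)))"
    using N P_eq_0[OF i _ policy_action[OF mu i]] by (intro sum.mono_neutral_left) auto
  finally show ?thesis by simp
qed

text \<open>Absorption is certain because the graph has no cycles; the total weight 1 passes from
  successors to \<open>i\<close> by first-step analysis.\<close>

lemma sum_pathprob: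
  assumes mu: "mu \<in> policies n A" and "i \<in> S"
  shows "(\<Sum>tau\<in>paths i. pathprob P mu tau) = 1"
  using \<open>i \<in> S\<close>
proof (induction i rule: wf_induct_rule[OF wf_G])
  case (1 i)
  have a: "mu i \<in> A i" using policy_action mu 1 by blast
  have "(\<Sum>tau\<in>paths i. pathprob P mu tau)
      = P i (mu i) 0 + (\<Sum>j\<in>S. P i (mu i) j * (\<Sum>sig\<in>paths j. pathprob P mu sig))"
    using sum_paths[OF mu 1(2), of "\<lambda>_. 1"] by simp
  also have "(\<Sum>j\<in>S. P i (mu i) j * (\<Sum>sig\<in>paths j. pathprob P mu sig)) = (\<Sum>j\<in>S. P i (mu i) j)"
    using 1 P_eq_0[OF 1(2) _ a] by (intro sum.cong refl) (metis converse_iff mult_1_right mult_zero_left)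
  finally show ?case using P_sum_split[OF 1(2) a] by simp
qed

lemma Jpol_bellman:
  assumes mu: "mu \<in> policies n A" and i: "i \<in> S"
  shows "Jpol n P c mu i = Qval n P c (Jpol n P c mu) i (mu i)"
proof -
  let ?u = "mu i"
  have "Jpol n P c mu i = P i ?u 0 * c i ?u +
      (\<Sum>j\<in>S. P i ?u j * (\<Sum>sig\<in>paths j. pathprob P mu sig * (c i ?u + pathcost c mu sig)))"
    unfolding Jpol_eq_sum_paths[OF mu] by (simp add: sum_paths[OF mu i])
  also have "\<dots> = P i ?u 0 * c i ?u + (\<Sum>j\<in>S. P i ?u j * (c i ?u + Jpol n P c mu j))"
    using sum_pathprob[OF mu] Jpol_eq_sum_paths[OF mu]
    by (simp add: distrib_left sum.distrib sum_distrib_right[symmetric])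
  also have "\<dots> = c i ?u * (P i ?u 0 + (\<Sum>j\<in>S. P i ?u j)) + (\<Sum>j\<in>S. P i ?u j * Jpol n P c mu j)"
    by (simp add: algebra_simps sum.distrib sum_distrib_left)
  also have "\<dots> = Qval n P c (Jpol n P c mu) i ?u"
    using P_sum_split[OF i policy_action[OF mu i]] by (simp add: Qval_def)
  finally show ?thesis .
qed

section \<open>Trajectories from the initial distribution and the first visit\<close>

text \<open>Splitting by the initial state: the empty trajectory starts in 0 with weight
  \<open>p 0\<close>, and those starting in \<open>j\<close> carry \<open>p j\<close>
  altogether.\<close>

lemma sum_trajprob:
  assumes mu: "mu \<in> policies n A"
  shows "(\<Sum>tau\<in>trajs n. trajprob n p P mu tau) = 1"
proof -
  let ?D = "\<lambda>j. {tau\<in>trajs n. tau \<noteq> [] \<and> hd tau = j}"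
  let ?U = "\<Union>j\<in>S. ?D j"
  have "tau \<in> ?U" if "tau \<in> trajs n" "tau \<noteq> []" for tau
    using that hd_in_set[of tau] unfolding trajs_def by blast
  moreover have "[] \<in> trajs n" by (simp add: trajs_def)
  ultimately have "trajs n = insert [] ?U" by blast
  then have "(\<Sum>tau\<in>trajs n. trajprob n p P mu tau) = (\<Sum>tau\<in>insert [] ?U. trajprob n p P mu tau)"
    by (rule arg_cong)
  also have "\<dots> = p 0 + (\<Sum>tau\<in>?U. trajprob n p P mu tau)"
    by (subst sum.insert) (auto simp: trajprob_def)
  also have "(\<Sum>tau\<in>(\<Union>j\<in>S. ?D j). trajprob n p P mu tau) = (\<Sum>j\<in>S. \<Sum>tau\<in>?D j. trajprob n p P mu tau)"
    by (intro sum.UNION_disjoint) auto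
  also have "\<dots> = (\<Sum>j\<in>S. p j)"
  proof (rule sum.cong[OF refl])
    fix j assume j: "j \<in> S"
    have "(\<Sum>tau\<in>?D j. trajprob n p P mu tau) = (\<Sum>tau\<in>?D j. p j * (pathprob P mu tau * 1))"
      by (intro sum.cong) (auto simp: trajprob_def trajs_def split: list.split)
    also have "\<dots> = p j"
      using sum_pathprob[OF mu j] unfolding sum_distrib_left[symmetric] sum_trajs_from[OF mu] by simp
    finally show "(\<Sum>tau\<in>?D j. trajprob n p P mu tau) = p j" .
  qed
  finally show ?thesis using p_sum_split by simp
qed

text \<open>Strong Markov property at the first visit to \<open>i\<close>: the visited part \<open>rho\<close> before \<open>i\<close> and the
  remaining path from \<open>i\<close> have independent weights.\<close>

lemma first_visit_factor:
  assumes mu: "mu \<in> policies n A" and i: "i \<in> S"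
  shows "(\<Sum>tau\<in>{tau\<in>trajs n. i \<in> set tau}. trajprob n p P mu tau * F (dropWhile (\<lambda>x. x \<noteq> i) tau))
       = visit_prob n p P mu i * (\<Sum>sig\<in>paths i. pathprob P mu sig * F sig)"
proof -
  \<comment> \<open>\<open>R\<close> holds the possible prefixes before the first visit to
    \<open>i\<close>, including the last edge into \<open>i\<close>. The empty prefix means starting
    in \<open>i\<close>, and \<open>w\<close> then gives \<open>p i\<close>.\<close>
  define R where "R = {rho. i \<notin> set rho \<and> set rho \<subseteq> S \<and> chain (rho @ [i])}"
  define w where "w rho = p (hd (rho @ [i])) * edgeprob P mu rho i" for rho
  let ?W = "{tau. set tau \<subseteq> S \<and> chain tau \<and> i \<in> set tau}"
  have cut: "takeWhile (\<lambda>x. x \<noteq> i) (rho @ sig) = rho \<and> dropWhile (\<lambda>x. x \<noteq> i) (rho @ sig) = sig"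
    if rs: "rho \<in> R" "sig \<in> paths i" for rho sig
  proof -
    obtain s where s: "sig = i # s" using rs(2) by (cases sig) (auto simp: paths_def)
    have "\<And>x. x \<in> set rho \<Longrightarrow> x \<noteq> i" using rs by (auto simp: R_def)
    then show ?thesis by (simp add: s takeWhile_append2 dropWhile_append2)
  qed
  have inj: "inj_on (\<lambda>(rho, sig). rho @ sig) (R \<times> paths i)"
    by (rule inj_on_inverseI[where g = "\<lambda>tau. (takeWhile (\<lambda>x. x \<noteq> i) tau, dropWhile (\<lambda>x. x \<noteq> i) tau)"])
      (use cut in auto)
  have W: "?W = (\<lambda>(rho, sig). rho @ sig) ` (R \<times> paths i)"
  proof (intro set_eqI iffI)
    fix tau assume tau: "tau \<in> ?W"
    then obtain rho s where *: "tau = rho @ i # s" "i \<notin> set rho" by (auto dest: split_list_first)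
    then have "rho \<in> R" "i # s \<in> paths i"
      using tau by (auto simp: R_def paths_def successively_append_iff)
    then show "tau \<in> (\<lambda>(rho, sig). rho @ sig) ` (R \<times> paths i)" using * by force
  next
    fix tau assume "tau \<in> (\<lambda>(rho, sig). rho @ sig) ` (R \<times> paths i)"
    then obtain rho s where "tau = rho @ i # s" "rho \<in> R" "i # s \<in> paths i"
      by (smt (verit) case_prod_conv imageE list.exhaust_sel mem_Sigma_iff old.prod.exhaust paths_hd paths_not_Nil)
    then show "tau \<in> ?W"
      by (simp add: R_def paths_def successively_append_iff)
  qed
  \<comment> \<open>Proved for every \<open>H\<close> because it is used twice: the constant 1
    identifies the total prefix weight with the visiting probability, and then \<open>F\<close>
    gives the claim.\<close>
  have *: "(\<Sum>tau\<in>{tau\<in>trajs n. i \<in> set tau}. trajprob n p P mu tau * H (dropWhile (\<lambda>x. x \<noteq> i) tau))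
       = (\<Sum>rho\<in>R. w rho) * (\<Sum>sig\<in>paths i. pathprob P mu sig * H sig)" for H
  proof -
    have "(\<Sum>tau\<in>{tau\<in>trajs n. i \<in> set tau}. trajprob n p P mu tau * H (dropWhile (\<lambda>x. x \<noteq> i) tau))
        = (\<Sum>tau\<in>?W. trajprob n p P mu tau * H (dropWhile (\<lambda>x. x \<noteq> i) tau))"
    proof (rule sum.mono_neutral_right)
      show "?W \<subseteq> {tau\<in>trajs n. i \<in> set tau}"
        using chain_distinct by (auto simp: trajs_def)
      show "\<forall>tau\<in>{tau\<in>trajs n. i \<in> set tau} - ?W.
          trajprob n p P mu tau * H (dropWhile (\<lambda>x. x \<noteq> i) tau) = 0"
        using trajprob_not_chain[OF mu] by (auto simp: trajs_def)
    qed simp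
    also have "\<dots> = (\<Sum>(rho, sig)\<in>R \<times> paths i. trajprob n p P mu (rho @ sig) * H (dropWhile (\<lambda>x. x \<noteq> i) (rho @ sig)))"
      unfolding W by (subst sum.reindex[OF inj]) (simp add: case_prod_unfold)
    also have "\<dots> = (\<Sum>(rho, sig)\<in>R \<times> paths i. w rho * (pathprob P mu sig * H sig))"
    proof (intro sum.cong refl, clarify)
      fix rho sig assume rs: "rho \<in> R" "sig \<in> paths i"
      then obtain s where s: "sig = i # s" by (cases sig) (auto simp: paths_def)
      have "trajprob n p P mu (rho @ sig) = p (hd (rho @ [i])) * pathprob P mu (rho @ sig)"
        using rs s by (cases rho) (auto simp: trajprob_def R_def paths_def)
      also have "\<dots> = w rho * pathprob P mu sig"
        by (simp add: s pathprob_append w_def)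
      finally show "trajprob n p P mu (rho @ sig) * H (dropWhile (\<lambda>x. x \<noteq> i) (rho @ sig))
          = w rho * (pathprob P mu sig * H sig)"
        using cut[OF rs] by simp
    qed
    also have "\<dots> = (\<Sum>rho\<in>R. w rho) * (\<Sum>sig\<in>paths i. pathprob P mu sig * H sig)"
      by (simp add: sum.cartesian_product[symmetric] sum_product)
    finally show ?thesis .
  qed
  from *[of "\<lambda>_. 1"] have "visit_prob n p P mu i = (\<Sum>rho\<in>R. w rho)"
    using sum_pathprob[OF mu i] by (simp add: visit_prob_def)
  with *[of F] show ?thesis by simp
qed

text \<open>By the factorization at the first visit, the cost collected from \<open>i\<close> on has
  conditional mean \<open>Jpol\<close>. This makes the simulation error a martingale
  difference.\<close>

lemma tailcost_centered:
  assumes mu: "mu \<in> policies n A" and i: "i \<in> S"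
  shows "(\<Sum>tau\<in>{tau\<in>trajs n. i \<in> set tau}.
            trajprob n p P mu tau * (tailcost c mu tau i - Jpol n P c mu i)) = 0"
  using first_visit_factor[OF mu i, of "\<lambda>sig. pathcost c mu sig - Jpol n P c mu i"]
    sum_pathprob[OF mu i] Jpol_eq_sum_paths[OF mu, of i]
  by (simp add: tailcost_def right_diff_distrib sum_subtractf sum_distrib_right[symmetric])

section \<open>The optimal value\<close>

text \<open>The solution of the Bellman optimality equation by recursion along the graph. The guard
  restricts recursive calls to successors; on \<open>S\<close> it changes nothing, as admissible
  actions have probability zero off the edges.\<close>

definition V :: "nat \<Rightarrow> real" where
  "V = wfrec (G\<inverse>) (\<lambda>f i. Min ((\<lambda>u. c i u + (\<Sum>j\<in>S. if (i, j) \<in> G then P i u j * f j else 0)) ` A i))"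

lemma V_eq:
  assumes i: "i \<in> S"
  shows "V i = Min (Qval n P c V i ` A i)"
proof -
  have "V i = Min ((\<lambda>u. c i u + (\<Sum>j\<in>S. if (i, j) \<in> G then P i u j * V j else 0)) ` A i)"
    unfolding V_def by (subst wfrec[OF wf_G]) (simp add: cut_def cong: if_cong)
  also have "(\<lambda>u. c i u + (\<Sum>j\<in>S. if (i, j) \<in> G then P i u j * V j else 0)) ` A i = Qval n P c V i ` A i"
    unfolding Qval_def by (intro image_cong refl arg_cong2[where f = "(+)"] sum.cong) (auto simp: P_eq_0[OF i])
  finally show ?thesis .
qed

lemma V_le_Qval: "i \<in> S \<Longrightarrow> u \<in> A i \<Longrightarrow> V i \<le> Qval n P c V i u"
  using V_eq[of i] A_fin[of i] by simp

lemma V_attained: "i \<in> S \<Longrightarrow> \<exists>u\<in>A i. Qval n P c V i u = V i"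
  using V_eq[of i] A_fin[of i] Min_in[of "Qval n P c V i ` A i"] by (metis atLeastAtMost_iff finite_imageI imageE image_is_empty le0)

lemma Qval_cong:
  assumes "i \<in> S" "u \<in> A i" "\<And>j. (i, j) \<in> G \<Longrightarrow> J j = J' j"
  shows "Qval n P c J i u = Qval n P c J' i u"
proof -
  have "P i u j * J j = P i u j * J' j" if "j \<in> S" for j
    using assms P_eq_0[OF assms(1) that assms(2)] by (cases "(i, j) \<in> G") auto
  then have "(\<Sum>j\<in>S. P i u j * J j) = (\<Sum>j\<in>S. P i u j * J' j)" by (rule sum.cong[OF refl])
  then show ?thesis by (simp add: Qval_def)
qed

text \<open>The inductive step shared by the construction of an optimal policy and the eventual
  optimality of the simulated policies.\<close>

lemma Jpol_greedy_V:
  assumes mu: "mu \<in> policies n A" and i: "i \<in> S"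
    and succ: "\<And>j. (i, j) \<in> G \<Longrightarrow> Jpol n P c mu j = V j"
    and greedy: "Qval n P c V i (mu i) = V i"
  shows "Jpol n P c mu i = V i"
  using Jpol_bellman[OF mu i] Qval_cong[OF i policy_action[OF mu i] succ] greedy by simp

text \<open>Backward induction: nonnegative transition weights make the Q-value monotone in the
  values of the successors.\<close>

lemma V_le_Jpol:
  assumes mu: "mu \<in> policies n A" and "i \<in> S"
  shows "V i \<le> Jpol n P c mu i"
  using \<open>i \<in> S\<close>
proof (induction i rule: wf_induct_rule[OF wf_G])
  case (1 i)
  have a: "mu i \<in> A i" using policy_action mu 1 by blast
  have "V i \<le> Qval n P c V i (mu i)" using V_le_Qval 1 a by blast
  also have "\<dots> \<le> Qval n P c (Jpol n P c mu) i (mu i)"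
    unfolding Qval_def
  proof (intro add_left_mono sum_mono)
    fix j assume j: "j \<in> S"
    show "P i (mu i) j * V j \<le> P i (mu i) j * Jpol n P c mu j"
    proof (cases "(i, j) \<in> G")
      case True
      then show ?thesis using 1 j P_nonneg[of i "mu i" j] a by (intro mult_left_mono) auto
    next
      case False
      then show ?thesis using P_eq_0[OF 1(2) j a] by simp
    qed
  qed
  finally show ?case using Jpol_bellman[OF mu 1(2)] by simp
qed

text \<open>Policies are unconstrained outside \<open>S\<close> and may be infinite in number, but a
  functional that reads only \<open>S\<close> factors through a finite product of action
  sets.\<close>

lemma finite_policy_image:
  assumes "\<And>mu mu'. (\<And>x. x \<in> S \<Longrightarrow> mu x = mu' x) \<Longrightarrow> F mu = F mu'"
  shows "finite (F ` policies n A)"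
proof -
  have "F ` policies n A \<subseteq> F ` (PiE S A)"
  proof
    fix y assume "y \<in> F ` policies n A"
    then obtain mu where mu: "mu \<in> policies n A" "y = F mu" by blast
    then have "restrict mu S \<in> PiE S A" using policy_action by auto
    moreover have "F mu = F (restrict mu S)" by (rule assms) auto
    ultimately show "y \<in> F ` (PiE S A)" using mu by blast
  qed
  moreover have "finite (PiE S A)" using A_fin by (intro finite_PiE) auto
  ultimately show ?thesis using finite_subset finite_imageI by blast
qed

text \<open>Choosing in every state an action attaining \<open>V\<close> gives a single policy whose
  value is \<open>V\<close> throughout \<open>S\<close>; no policy does better.\<close>

lemma Jstar_eq_V:
  assumes i: "i \<in> S"
  shows "Jstar n A P c i = V i"
proof -
  have "\<forall>x. \<exists>u. x \<in> S \<longrightarrow> u \<in> A x \<and> Qval n P c V x u = V x" using V_attained by blast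
  then obtain mu where mu: "\<And>x. x \<in> S \<Longrightarrow> mu x \<in> A x \<and> Qval n P c V x (mu x) = V x" by metis
  then have pol: "mu \<in> policies n A" by (simp add: policies_def)
  have opt: "Jpol n P c mu i = V i"
    using i
  proof (induction i rule: wf_induct_rule[OF wf_G])
    case (1 i)
    then show ?case using Jpol_greedy_V[OF pol 1(2)] mu G_subset by blast
  qed
  show ?thesis
    unfolding Jstar_def
  proof (rule Min_eqI)
    show "finite ((\<lambda>mu. Jpol n P c mu i) ` policies n A)"
      by (rule finite_policy_image) (rule Jpol_cong)
    show "V i \<le> y" if "y \<in> (\<lambda>mu. Jpol n P c mu i) ` policies n A" for y
      using that V_le_Jpol i by blast
    show "V i \<in> (\<lambda>mu. Jpol n P c mu i) ` policies n A"
      using opt pol by (metis imageI)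
  qed
qed

text \<open>Visiting probabilities take finitely many values over all policies, so positivity is
  uniform and survives a policy that changes with the history.\<close>

lemma visit_prob_lower_bound:
  assumes "\<And>m. m \<in> policies n A \<Longrightarrow> visit_prob n p P m i > 0"
  obtains q where "q > 0" "\<And>m. m \<in> policies n A \<Longrightarrow> q \<le> visit_prob n p P m i"
proof -
  let ?I = "(\<lambda>m. visit_prob n p P m i) ` policies n A"
  have fin: "finite ?I" by (rule finite_policy_image) (rule visit_prob_cong)
  show ?thesis
  proof (rule that)
    \<comment> \<open>Inserting 1 keeps the minimum over a nonempty set without exhibiting a
      policy.\<close>
    show "Min (insert 1 ?I) > 0" using fin assms by (subst Min_gr_iff) auto
    show "Min (insert 1 ?I) \<le> visit_prob n p P m i" if "m \<in> policies n A" for m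
      using fin that by (intro Min_le) auto
  qed
qed

section \<open>Cost bounds uniform over policies\<close>

definition cmax :: real where
  "cmax = (\<Sum>x\<in>S. \<Sum>u\<in>A x. c x u)"

text \<open>A trajectory visits each state at most once, so it pays at most one action cost per
  state.\<close>

lemma pathcost_bounds:
  assumes mu: "mu \<in> policies n A" and tau: "tau \<in> trajs n"
  shows "0 \<le> pathcost c mu tau" "pathcost c mu tau \<le> cmax"
proof -
  have S: "set tau \<subseteq> S" and d: "distinct tau" using tau by (auto simp: trajs_def)
  have eq: "pathcost c mu tau = (\<Sum>x\<in>set tau. c x (mu x))"
    using d by (simp add: pathcost_def sum_list_distinct_conv_sum_set)
  have c: "0 \<le> c x u" if "x \<in> S" "u \<in> A x" for x u
    using that c_nonneg[of x u] by simp
  show "0 \<le> pathcost c mu tau"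
    unfolding eq using S by (intro sum_nonneg c policy_action[OF mu]) auto
  have "pathcost c mu tau \<le> (\<Sum>x\<in>S. c x (mu x))"
    unfolding eq using S by (intro sum_mono2) (auto intro!: c policy_action[OF mu])
  also have "\<dots> \<le> cmax"
    unfolding cmax_def
    using A_fin by (intro sum_mono member_le_sum) (auto intro!: c policy_action[OF mu])
  finally show "pathcost c mu tau \<le> cmax" .
qed

lemma Jpol_bounds:
  assumes mu: "mu \<in> policies n A" and i: "i \<in> S"
  shows "0 \<le> Jpol n P c mu i" "Jpol n P c mu i \<le> cmax"
proof -
  have pp: "pathprob P mu tau \<ge> 0" if "tau \<in> paths i" for tau
    using that by (intro pathprob_nonneg[OF mu]) (auto simp: paths_def)
  note pc = pathcost_bounds[OF mu subsetD[OF paths_subset_trajs]]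
  show "0 \<le> Jpol n P c mu i"
    unfolding Jpol_eq_sum_paths[OF mu] by (intro sum_nonneg mult_nonneg_nonneg pp pc(1))
  have "Jpol n P c mu i \<le> (\<Sum>tau\<in>paths i. pathprob P mu tau * cmax)"
    unfolding Jpol_eq_sum_paths[OF mu] by (intro sum_mono mult_left_mono pp pc(2))
  also have "\<dots> = cmax" using sum_pathprob[OF mu i] by (simp add: sum_distrib_right[symmetric])
  finally show "Jpol n P c mu i \<le> cmax" .
qed

lemma abs_tailcost_minus_Jpol_le:
  assumes mu: "mu \<in> policies n A" and i: "i \<in> S" and tau: "tau \<in> trajs n"
  shows "\<bar>tailcost c mu tau i - Jpol n P c mu i\<bar> \<le> cmax"
proof -
  have "dropWhile (\<lambda>x. x \<noteq> i) tau \<in> trajs n"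
    using tau set_dropWhileD by (fastforce simp: trajs_def)
  from pathcost_bounds[OF mu this] Jpol_bounds[OF mu i] show ?thesis
    unfolding tailcost_def by linarith
qed

end

section \<open>Simulation under greedy policies\<close>

context ssp
begin

lemma Qval_tendsto:
  assumes i: "i \<in> S" and u: "u \<in> A i"
    and J: "\<And>j. (i, j) \<in> G \<Longrightarrow> (\<lambda>t. J t j) \<longlonglongrightarrow> W j"
  shows "(\<lambda>t. Qval n P c (J t) i u) \<longlonglongrightarrow> Qval n P c W i u"
  unfolding Qval_def
proof (intro tendsto_add tendsto_const tendsto_sum)
  fix j assume j: "j \<in> S"
  show "(\<lambda>t. P i u j * J t j) \<longlonglongrightarrow> P i u j * W j"
  proof (cases "(i, j) \<in> G")
    case True
    then show ?thesis by (intro tendsto_mult tendsto_const J)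
  next
    case False
    then show ?thesis using P_eq_0[OF i j u] by simp
  qed
qed

text \<open>At the limit each nonoptimal action lies strictly above an optimal one. With finitely
  many actions these gaps eventually persist for \<open>J t\<close>, so a greedy choice is optimal.
  The choice itself need not settle when optimal actions tie.\<close>

lemma eventually_greedy_optimal:
  assumes i: "i \<in> S"
    and J: "\<And>j. (i, j) \<in> G \<Longrightarrow> (\<lambda>t. J t j) \<longlonglongrightarrow> V j"
    and m: "\<And>t. m t \<in> A i"
    and greedy: "\<And>t u. u \<in> A i \<Longrightarrow> Qval n P c (J t) i (m t) \<le> Qval n P c (J t) i u"
  shows "\<forall>\<^sub>F t in sequentially. Qval n P c V i (m t) = V i"
proof -
  obtain b where b: "b \<in> A i" "Qval n P c V i b = V i" using V_attained[OF i] by blast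
  let ?bad = "{u\<in>A i. Qval n P c V i u \<noteq> V i}"
  have "\<forall>\<^sub>F t in sequentially. \<forall>u\<in>?bad. Qval n P c (J t) i b < Qval n P c (J t) i u"
  proof (rule eventually_ball_finite)
    show "finite ?bad" using A_fin[of i] i by auto
    show "\<forall>u\<in>?bad. \<forall>\<^sub>F t in sequentially. Qval n P c (J t) i b < Qval n P c (J t) i u"
    proof
      fix u assume u: "u \<in> ?bad"
      then have "Qval n P c V i b < Qval n P c V i u"
        using V_le_Qval[OF i, of u] b by auto
      then obtain z where z: "Qval n P c V i b < z" "z < Qval n P c V i u" using dense by blast
      have "(\<lambda>t. Qval n P c (J t) i u) \<longlonglongrightarrow> Qval n P c V i u"
        using u by (intro Qval_tendsto[OF i _ J]) auto
      then have "\<forall>\<^sub>F t in sequentially. z < Qval n P c (J t) i u"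
        using z(2) by (rule order_tendstoD)
      moreover have "(\<lambda>t. Qval n P c (J t) i b) \<longlonglongrightarrow> Qval n P c V i b"
        by (intro Qval_tendsto[OF i b(1) J])
      then have "\<forall>\<^sub>F t in sequentially. Qval n P c (J t) i b < z"
        using z(1) by (rule order_tendstoD)
      ultimately show "\<forall>\<^sub>F t in sequentially. Qval n P c (J t) i b < Qval n P c (J t) i u"
        by eventually_elim linarith
    qed
  qed
  then show ?thesis
  proof eventually_elim
    case (elim t)
    then show ?case using m[of t] greedy[OF b(1), of t] by fastforce
  qed
qed

text \<open>Once all successors of \<open>i\<close> have settled on optimal actions, the simulated cost from \<open>i\<close> is an
  unbiased sample of \<open>V i\<close>, so that \<open>i\<close> settles as well.\<close>

lemma greedy_iteration_tendsto_V:
  assumes pol: "\<And>t. m t \<in> policies n A"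
    and greedy: "\<And>t i u. i \<in> S \<Longrightarrow> u \<in> A i \<Longrightarrow> Qval n P c (J t) i (m t i) \<le> Qval n P c (J t) i u"
    and rec: "\<And>t i. i \<in> S \<Longrightarrow>
        J (Suc t) i = (1 - a i t) * J t i + a i t * Jpol n P c (m t) i + e i t"
    and a: "\<And>i t. 0 \<le> a i t" "\<And>i t. a i t \<le> 1"
    and div: "\<And>i. i \<in> S \<Longrightarrow> filterlim (\<lambda>N. \<Sum>t<N. a i t) at_top sequentially"
    and e: "\<And>i. i \<in> S \<Longrightarrow> convergent (\<lambda>N. \<Sum>t<N. e i t)"
    and "i \<in> S"
  shows "(\<lambda>t. J t i) \<longlonglongrightarrow> V i"
proof -
  \<comment> \<open>The induction also carries the eventual equality of policy values: to have
    policy value \<open>V i\<close> at \<open>i\<close>, the current policy must be optimal at the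
    successors as well.\<close>
  have "(\<lambda>t. J t i) \<longlonglongrightarrow> V i \<and> (\<forall>\<^sub>F t in sequentially. Jpol n P c (m t) i = V i)"
    using \<open>i \<in> S\<close>
  proof (induction i rule: wf_induct_rule[OF wf_G])
    case (1 i)
    let ?N = "{j. (i, j) \<in> G}"
    have N: "?N \<subseteq> S" using G_subset by auto
    have J: "(\<lambda>t. J t j) \<longlonglongrightarrow> V j" if "(i, j) \<in> G" for j
      using 1 that N by blast
    have "\<forall>j\<in>?N. \<forall>\<^sub>F t in sequentially. Jpol n P c (m t) j = V j"
      using 1 N by blast
    moreover have "finite ?N" using N by (rule finite_subset) simp
    ultimately have "\<forall>\<^sub>F t in sequentially. \<forall>j\<in>?N. Jpol n P c (m t) j = V j"
      by (intro eventually_ball_finite)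
    moreover have "\<forall>\<^sub>F t in sequentially. Qval n P c V i (m t i) = V i"
      by (rule eventually_greedy_optimal[OF 1(2) J]) (use 1(2) policy_action[OF pol] greedy in auto)
    ultimately have ev: "\<forall>\<^sub>F t in sequentially. Jpol n P c (m t) i = V i"
      by eventually_elim (rule Jpol_greedy_V[OF pol 1(2)], simp_all)
    have "(\<lambda>t. J t i) \<longlonglongrightarrow> V i"
      by (rule robbins_monro_tendsto[OF rec[OF 1(2)] a tendsto_eventually[OF ev] div[OF 1(2)] e[OF 1(2)]])
    with ev show ?case by blast
  qed
  then show ?thesis ..
qed

end

section \<open>Visit counts and dependence on the past\<close>

lemma nvis_Suc: "nvis xs (Suc t) i = nvis xs t i + (if i \<in> set (xs t) then 1 else 0)"
proof -
  have "{k. k < Suc t \<and> i \<in> set (xs k)}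
      = (if i \<in> set (xs t) then insert t {k. k < t \<and> i \<in> set (xs k)} else {k. k < t \<and> i \<in> set (xs k)})"
    by (auto simp: less_Suc_eq)
  then show ?thesis by (simp add: nvis_def)
qed

lemma nvis_0 [simp]: "nvis xs 0 i = 0"
  by (simp add: nvis_def)

text \<open>\<open>nvis xs k i\<close> counts visits strictly before \<open>k\<close>, so successive
  visits use the indices 0, 1, 2, ... once each.\<close>

lemma sum_over_visits:
  fixes f :: "nat \<Rightarrow> real"
  shows "(\<Sum>k<N. if i \<in> set (xs k) then f (nvis xs k i) else 0) = (\<Sum>j<nvis xs N i. f j)"
  by (induction N) (auto simp: nvis_Suc)

lemma nvis_cong:
  assumes "\<And>k. k < t \<Longrightarrow> xs k = ys k"
  shows "nvis xs t i = nvis ys t i"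
proof -
  have "{k. k < t \<and> i \<in> set (xs k)} = {k. k < t \<and> i \<in> set (ys k)}" using assms by auto
  then show ?thesis by (simp add: nvis_def)
qed

text \<open>The iterate at time \<open>t\<close> depends on the first \<open>t\<close> trajectories
  only, so it may be computed from a finite list although \<open>h ! k\<close> is unspecified beyond
  its length.\<close>

lemma Jseq_cong:
  assumes gam: "\<And>t. (\<And>k. k < t \<Longrightarrow> xs k = ys k) \<Longrightarrow> gam xs t = gam ys t"
    and "\<And>k. k < t \<Longrightarrow> xs k = ys k"
  shows "Jseq mu c gam xs t = Jseq mu c gam ys t"
  using assms(2)
proof (induction t)
  case (Suc t)
  have "map xs [0..<t] = map ys [0..<t]" "xs t = ys t" "gam xs t = gam ys t"
    using Suc.prems gam[of t] by simp_all
  moreover have "Jseq mu c gam xs t = Jseq mu c gam ys t" using Suc by simp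
  ultimately show ?case by (simp only: Jseq.simps)
qed simp

section \<open>Almost sure behaviour of the simulated trajectories\<close>

locale simulated_ssp = ssp n A P c p +
  history_process M X "\<lambda>h. trajprob n p P (mu h)" "trajs n"
  for n :: nat and A :: "nat \<Rightarrow> 'a set" and P c p
    and M :: "'w measure" and X :: "nat \<Rightarrow> 'w \<Rightarrow> nat list" and mu :: "nat list list \<Rightarrow> nat \<Rightarrow> 'a" +
  assumes mu_policy: "mu h \<in> policies n A"
begin

text \<open>The step size \<open>g\<close> is fixed by the history, so weighting keeps the error
  centered; the error is bounded by \<open>cmax\<close>. Leaving \<open>g\<close> abstract covers
  both step-size rules.\<close>

lemma AE_noise_convergent:
  fixes g :: "nat list list \<Rightarrow> real"
  assumes i: "i \<in> S"
    and bound: "\<And>N w. (\<Sum>k<N. if i \<in> set (X k w) then (g (H k w))\<^sup>2 else 0) \<le> C"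
  shows "AE w in M. convergent (\<lambda>N. \<Sum>k<N. if i \<in> set (X k w)
           then g (H k w) * (tailcost c (mu (H k w)) (X k w) i - Jpol n P c (mu (H k w)) i) else 0)"
proof -
  define D where "D h tau = tailcost c (mu h) tau i - Jpol n P c (mu h) i" for h tau
  define f where "f h tau = (if i \<in> set tau then g h * D h tau else 0)" for h tau
  have "mds f"
    unfolding mds_def
  proof (intro allI impI)
    fix h
    have "(\<Sum>tau\<in>trajs n. trajprob n p P (mu h) tau * f h tau)
        = (\<Sum>tau\<in>{tau\<in>trajs n. i \<in> set tau}. g h * (trajprob n p P (mu h) tau * D h tau))"
      by (rule sum.mono_neutral_cong_right) (auto simp: f_def)
    also have "\<dots> = 0"
      using tailcost_centered[OF mu_policy i, of h] by (simp add: sum_distrib_left[symmetric] D_def)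
    finally show "(\<Sum>tau\<in>trajs n. trajprob n p P (mu h) tau * f h tau) = 0" .
  qed
  moreover have "AE w in M. (\<Sum>k<N. (f (H k w) (X k w))\<^sup>2) \<le> C * cmax\<^sup>2" for N
    using AE_X_in_T
  proof eventually_elim
    case (elim w)
    have "(f (H k w) (X k w))\<^sup>2 \<le> (if i \<in> set (X k w) then (g (H k w))\<^sup>2 else 0) * cmax\<^sup>2" for k
    proof -
      have "\<bar>D (H k w) (X k w)\<bar> \<le> cmax"
        unfolding D_def using elim by (intro abs_tailcost_minus_Jpol_le mu_policy i) auto
      then have "(D (H k w) (X k w))\<^sup>2 \<le> cmax\<^sup>2" by (metis abs_ge_zero power2_abs power_mono)
      then show ?thesis by (auto simp: f_def power_mult_distrib intro: mult_left_mono)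
    qed
    then have "(\<Sum>k<N. (f (H k w) (X k w))\<^sup>2)
        \<le> (\<Sum>k<N. if i \<in> set (X k w) then (g (H k w))\<^sup>2 else 0) * cmax\<^sup>2"
      unfolding sum_distrib_right by (intro sum_mono)
    also have "\<dots> \<le> C * cmax\<^sup>2" by (intro mult_right_mono bound) simp
    finally show ?case .
  qed
  ultimately have "AE w in M. convergent (\<lambda>N. \<Sum>k<N. f (H k w) (X k w))"
    by (rule AE_convergent_psum)
  then show ?thesis unfolding f_def D_def .
qed

lemma visit_prob_range: "0 \<le> visit_prob n p P (mu h) i" "visit_prob n p P (mu h) i \<le> 1"
proof -
  show "0 \<le> visit_prob n p P (mu h) i"
    unfolding visit_prob_def by (intro sum_nonneg trajprob_nonneg mu_policy)
  have "visit_prob n p P (mu h) i \<le> (\<Sum>tau\<in>trajs n. trajprob n p P (mu h) tau)"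
    unfolding visit_prob_def by (intro sum_mono2) (auto intro: trajprob_nonneg mu_policy)
  then show "visit_prob n p P (mu h) i \<le> 1" using sum_trajprob[OF mu_policy] by simp
qed

text \<open>A conditional Borel--Cantelli argument: the difference between the weighted number of visits and
  its compensator converges, and the compensator is at least a multiple of \<open>\<Sum>k. b k\<close>.\<close>

lemma AE_weighted_visits_diverge:
  fixes b :: "nat \<Rightarrow> real"
  assumes visit: "\<And>m. m \<in> policies n A \<Longrightarrow> visit_prob n p P m i > 0"
    and b: "\<And>k. b k \<ge> 0" "\<not> summable b" "summable (\<lambda>k. (b k)\<^sup>2)"
  shows "AE w in M. filterlim (\<lambda>N. \<Sum>k<N. if i \<in> set (X k w) then b k else 0) at_top sequentially"
proof -
  obtain q where q: "q > 0" "\<And>m. m \<in> policies n A \<Longrightarrow> q \<le> visit_prob n p P m i"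
    using visit_prob_lower_bound[OF visit] by blast
  define Q where "Q h = visit_prob n p P (mu h) i" for h
  define v :: "nat list \<Rightarrow> real" where "v tau = (if i \<in> set tau then 1 else 0)" for tau
  define f where "f h tau = b (length h) * (v tau - Q h)" for h tau
  have "mds f"
    unfolding mds_def
  proof (intro allI impI)
    fix h
    have "(\<Sum>tau\<in>trajs n. trajprob n p P (mu h) tau * f h tau)
        = b (length h) * ((\<Sum>tau\<in>trajs n. trajprob n p P (mu h) tau * v tau)
            - Q h * (\<Sum>tau\<in>trajs n. trajprob n p P (mu h) tau))"
      by (simp add: f_def algebra_simps sum_subtractf sum_distrib_left)
    also have "(\<Sum>tau\<in>trajs n. trajprob n p P (mu h) tau * v tau) = Q h"
      unfolding Q_def visit_prob_def by (rule sum.mono_neutral_cong_right) (auto simp: v_def)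
    finally show "(\<Sum>tau\<in>trajs n. trajprob n p P (mu h) tau * f h tau) = 0"
      using sum_trajprob[OF mu_policy] by simp
  qed
  moreover have "AE w in M. (\<Sum>k<N. (f (H k w) (X k w))\<^sup>2) \<le> (\<Sum>k. (b k)\<^sup>2)" for N
  proof (rule AE_I2)
    fix w
    have "(f (H k w) (X k w))\<^sup>2 \<le> (b k)\<^sup>2" for k
    proof -
      have "\<bar>v (X k w) - Q (H k w)\<bar> \<le> 1"
        using visit_prob_range[of "H k w" i] by (auto simp: Q_def v_def)
      then have "\<bar>f (H k w) (X k w)\<bar> \<le> b k * 1"
        using b(1)[of k] unfolding f_def abs_mult by (intro mult_mono) auto
      then show ?thesis by (intro abs_le_square_iff[THEN iffD1]) auto
    qed
    then have "(\<Sum>k<N. (f (H k w) (X k w))\<^sup>2) \<le> (\<Sum>k<N. (b k)\<^sup>2)" by (intro sum_mono)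
    also have "\<dots> \<le> (\<Sum>k. (b k)\<^sup>2)" using b(3) by (intro sum_le_suminf) auto
    finally show "(\<Sum>k<N. (f (H k w) (X k w))\<^sup>2) \<le> (\<Sum>k. (b k)\<^sup>2)" .
  qed
  ultimately have "AE w in M. convergent (\<lambda>N. \<Sum>k<N. f (H k w) (X k w))"
    by (rule AE_convergent_psum)
  then show ?thesis
  proof eventually_elim
    case (elim w)
    then obtain l where l: "(\<lambda>N. \<Sum>k<N. f (H k w) (X k w)) \<longlonglongrightarrow> l" by (auto simp: convergent_def)
    have "filterlim (\<lambda>N. \<Sum>k<N. b k) at_top sequentially"
      using b by (intro filterlim_sum_at_top_not_summable)
    then have "filterlim (\<lambda>N. q * (\<Sum>k<N. b k)) at_top sequentially"
      using q by (intro filterlim_tendsto_pos_mult_at_top[OF tendsto_const])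
    then have "filterlim (\<lambda>N. (\<Sum>k<N. f (H k w) (X k w)) + q * (\<Sum>k<N. b k)) at_top sequentially"
      by (rule filterlim_tendsto_add_at_top[OF l])
    \<comment> \<open>Adding \<open>q * b k\<close> to the centered term leaves at most the weighted
      visit indicator, because \<open>q\<close> is at most the conditional visiting
      probability.\<close>
    moreover have "(\<Sum>k<N. f (H k w) (X k w)) + q * (\<Sum>k<N. b k)
        \<le> (\<Sum>k<N. if i \<in> set (X k w) then b k else 0)" for N
    proof -
      have "f (H k w) (X k w) + q * b k \<le> (if i \<in> set (X k w) then b k else 0)" for k
        using mult_left_mono[OF q(2)[OF mu_policy[of "H k w"]] b(1)[of k]]
        by (auto simp: f_def Q_def v_def algebra_simps)
      then show ?thesis
        unfolding sum_distrib_left sum.distrib[symmetric] by (intro sum_mono)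
    qed
    ultimately show ?case
      by (rule filterlim_at_top_mono[OF _ always_eventually[OF allI]])
  qed
qed

end

section \<open>Convergence of the iterates for both step-size rules\<close>

theorem theorem2:
  fixes n :: nat
    and A :: "nat \<Rightarrow> 'a set"
    and P :: "nat \<Rightarrow> 'a \<Rightarrow> nat \<Rightarrow> real"
    and c :: "nat \<Rightarrow> 'a \<Rightarrow> real"
    and p :: "nat \<Rightarrow> real"
    and beta :: "nat \<Rightarrow> real"
    and gam :: "(nat \<Rightarrow> nat list) \<Rightarrow> nat \<Rightarrow> nat \<Rightarrow> real"
    and mu :: "nat list list \<Rightarrow> nat \<Rightarrow> 'a"
    and M :: "'w measure"
    and X :: "nat \<Rightarrow> 'w \<Rightarrow> nat list"
  assumes A_fin: "\<forall>i\<in>{0..n}. finite (A i) \<and> A i \<noteq> {}"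
    and P_nonneg: "\<forall>i\<in>{0..n}. \<forall>u\<in>A i. \<forall>j. P i u j \<ge> 0"
    and P_supp: "\<forall>i\<in>{0..n}. \<forall>u\<in>A i. \<forall>j. j > n \<longrightarrow> P i u j = 0"
    and P_sum: "\<forall>i\<in>{0..n}. \<forall>u\<in>A i. (\<Sum>j\<in>{0..n}. P i u j) = 1"
    and c_nonneg: "\<forall>i\<in>{0..n}. \<forall>u\<in>A i. c i u \<ge> 0"
    and p_nonneg: "\<forall>j. p j \<ge> 0"
    and p_supp: "\<forall>j. j > n \<longrightarrow> p j = 0"
    and p_sum: "(\<Sum>j\<in>{0..n}. p j) = 1"
    \<comment> \<open>(A1)\<close>
    and A1: "\<forall>m\<in>policies n A. \<forall>i\<in>{1..n}. visit_prob n p P m i > 0"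
    \<comment> \<open>(A2)\<close>
    and A2: "\<forall>i\<in>{0..n}. \<forall>j\<in>{0..n}. \<forall>u\<in>A i. \<forall>v\<in>A i. (P i u j > 0 \<longleftrightarrow> P i v j > 0)"
    \<comment> \<open>(A4)\<close>
    and A4_absorb: "\<forall>u\<in>A 0. P 0 u 0 = 1 \<and> c 0 u = 0"
    and A4_acyclic: "acyclic (reach_graph n A P)"
    \<comment> \<open>step sizes\<close>
    and beta_range: "\<forall>t. 0 < beta t \<and> beta t \<le> 1"
    and beta_div: "\<not> summable beta"
    and beta_sq: "summable (\<lambda>t. (beta t)\<^sup>2)"
    and beta_mono: "\<exists>T0. \<forall>s t. T0 < s \<longrightarrow> s \<le> t \<longrightarrow> beta t \<le> beta s"
    and gam_def: "gam = (\<lambda>xs t i. beta (nvis xs t i)) \<or> gam = (\<lambda>xs t i. beta t)"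
    \<comment> \<open>greedy policy selection (any tie-breaking depending on the history)\<close>
    and greedy: "\<forall>h. \<forall>i\<in>{1..n}. mu h i \<in> A i \<and>
        (\<forall>u\<in>A i. Qval n P c (Jseq mu c gam (\<lambda>k. h ! k) (length h)) i (mu h i)
                 \<le> Qval n P c (Jseq mu c gam (\<lambda>k. h ! k) (length h)) i u)"
    \<comment> \<open>the simulated trajectories: joint law of X 0, ..., X (t-1)\<close>
    and M_prob: "prob_space M"
    and X_meas: "\<forall>t. X t \<in> measurable M (count_space UNIV)"
    and X_law: "\<forall>t taus. length taus = t \<longrightarrow>
        measure M {w\<in>space M. \<forall>k<t. X k w = taus ! k}
          = (\<Prod>k<t. trajprob n p P (mu (take k taus)) (taus ! k))"
  shows "AE w in M. \<forall>i\<in>{1..n}.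
           (\<lambda>t. Jseq mu c gam (\<lambda>k. X k w) t i) \<longlonglongrightarrow> Jstar n A P c i"
proof -
  have ssp: "ssp n A P c p"
    using A_fin P_nonneg P_sum c_nonneg p_nonneg p_sum A4_acyclic by unfold_locales auto
  interpret ssp n A P c p by (rule ssp)
  have mu_policy: "mu h \<in> policies n A" for h
    using greedy by (simp add: policies_def)
  interpret simulated_ssp n A P c p M X mu
  proof (intro simulated_ssp.intro ssp history_process.intro M_prob history_process_axioms.intro
      simulated_ssp_axioms.intro mu_policy finite_trajs)
    show "X t \<in> measurable M (count_space UNIV)" for t using X_meas by blast
    show "trajprob n p P (mu h) tau = 0" if "tau \<notin> trajs n" for h tau
      using trajprob_not_traj mu_policy that by blast
    show "measure M {w\<in>space M. \<forall>k<length h. X k w = h ! k}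
        = (\<Prod>k<length h. trajprob n p P (mu (take k h)) (h ! k))" for h
      using X_law by blast
  qed
  have beta: "0 \<le> beta t" "beta t \<le> 1" for t using beta_range by (auto simp: less_imp_le)
  have gam_range: "0 \<le> gam xs t i" "gam xs t i \<le> 1" for xs t i
    using gam_def beta by auto
  have gam_cong: "gam xs t = gam ys t" if "\<And>k. k < t \<Longrightarrow> xs k = ys k" for xs ys t
    using gam_def nvis_cong[of t xs ys] that by (auto simp: fun_eq_iff)
  let ?xs = "\<lambda>w k. X k w"
  have nth_H: "H t w ! k = X k w" if "k < t" for k t w
    using that by (simp add: H_def)
  have gam_H: "gam (\<lambda>k. H t w ! k) t = gam (?xs w) t" for t w
    by (rule gam_cong) (rule nth_H)
  have Jseq_H: "Jseq mu c gam (\<lambda>k. H t w ! k) t = Jseq mu c gam (?xs w) t" for t w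
    by (rule Jseq_cong[OF gam_cong nth_H])
  \<comment> \<open>Step size and noise vanish when \<open>i\<close> is not visited, so one
    recursion covers both cases of the update.\<close>
  define a where "a w i t = (if i \<in> set (X t w) then gam (?xs w) t i else 0)" for w i t
  define e where "e w i t = (if i \<in> set (X t w)
      then gam (?xs w) t i * (tailcost c (mu (H t w)) (X t w) i - Jpol n P c (mu (H t w)) i) else 0)" for w i t
  have rec: "Jseq mu c gam (?xs w) (Suc t) i
      = (1 - a w i t) * Jseq mu c gam (?xs w) t i + a w i t * Jpol n P c (mu (H t w)) i + e w i t" for w t i
    by (simp add: a_def e_def H_def hist_def algebra_simps)
  \<comment> \<open>Visit-indexed steps use an initial segment of \<open>beta\<close>, time-indexed
    steps a subset of its indices; either way the squares stay below the full series.\<close>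
  have sq: "(\<Sum>t<N. if i \<in> set (X t w) then (gam (?xs w) t i)\<^sup>2 else 0) \<le> (\<Sum>t. (beta t)\<^sup>2)" for N w i
    using gam_def
  proof
    assume g: "gam = (\<lambda>xs t i. beta (nvis xs t i))"
    have "(\<Sum>t<N. if i \<in> set (X t w) then (gam (?xs w) t i)\<^sup>2 else 0) = (\<Sum>j<nvis (?xs w) N i. (beta j)\<^sup>2)"
      unfolding g using sum_over_visits[of i "?xs w" "\<lambda>j. (beta j)\<^sup>2" N] by simp
    also have "\<dots> \<le> (\<Sum>t. (beta t)\<^sup>2)" using beta_sq by (intro sum_le_suminf) auto
    finally show ?thesis .
  next
    assume g: "gam = (\<lambda>xs t i. beta t)"
    have "(\<Sum>t<N. if i \<in> set (X t w) then (gam (?xs w) t i)\<^sup>2 else 0) \<le> (\<Sum>t<N. (beta t)\<^sup>2)"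
      unfolding g by (intro sum_mono) auto
    also have "\<dots> \<le> (\<Sum>t. (beta t)\<^sup>2)" using beta_sq by (intro sum_le_suminf) auto
    finally show ?thesis .
  qed
  have noise: "AE w in M. convergent (\<lambda>N. \<Sum>t<N. e w i t)" if i: "i \<in> S" for i
    using AE_noise_convergent[OF i, of "\<lambda>h. gam (\<lambda>k. h ! k) (length h) i",
        unfolded H_simps gam_H, OF sq]
    unfolding e_def .
  have visits: "AE w in M. filterlim (\<lambda>N. \<Sum>t<N. a w i t) at_top sequentially" if i: "i \<in> S" for i
  proof -
    \<comment> \<open>For time-indexed steps this is already the claim. For visit-indexed steps
      \<open>beta t \<le> 1\<close> turns it into infinitely many visits, which run through the
      whole divergent series.\<close>
    have "AE w in M. filterlim (\<lambda>N. \<Sum>t<N. if i \<in> set (X t w) then beta t else 0) at_top sequentially"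
      using A1 i beta beta_div beta_sq by (intro AE_weighted_visits_diverge) auto
    then show ?thesis
      using gam_def
    proof (elim disjE)
      assume *: "AE w in M. filterlim (\<lambda>N. \<Sum>t<N. if i \<in> set (X t w) then beta t else 0) at_top sequentially"
      assume g: "gam = (\<lambda>xs t i. beta (nvis xs t i))"
      from * show ?thesis
      proof eventually_elim
        case (elim w)
        have "(\<Sum>t<N. if i \<in> set (X t w) then beta t else 0) \<le> real (nvis (?xs w) N i)" for N
        proof -
          have "(\<Sum>t<N. if i \<in> set (X t w) then beta t else 0) \<le> (\<Sum>t<N. if i \<in> set (X t w) then 1 else 0)"
            using beta by (intro sum_mono) auto
          then show ?thesis using sum_over_visits[of i "?xs w" "\<lambda>_. 1" N] by simp
        qed
        then have "filterlim (\<lambda>N. real (nvis (?xs w) N i)) at_top sequentially"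
          by (intro filterlim_at_top_mono[OF elim]) auto
        then have "filterlim (\<lambda>N. nvis (?xs w) N i) at_top sequentially"
          by (simp add: filterlim_sequentially_iff_filterlim_real)
        moreover have "filterlim (\<lambda>N. \<Sum>k<N. beta k) at_top sequentially"
          using beta beta_div by (intro filterlim_sum_at_top_not_summable)
        ultimately have "filterlim (\<lambda>N. \<Sum>j<nvis (?xs w) N i. beta j) at_top sequentially"
          by (rule filterlim_compose[rotated])
        then show ?case
          unfolding a_def g using sum_over_visits[of i "?xs w" beta] by simp
      qed
    qed (simp add: a_def cong: if_cong)
  qed
  have "AE w in M. \<forall>i\<in>S. convergent (\<lambda>N. \<Sum>t<N. e w i t)"
    using noise by (intro AE_finite_allI) auto
  moreover have "AE w in M. \<forall>i\<in>S. filterlim (\<lambda>N. \<Sum>t<N. a w i t) at_top sequentially"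
    using visits by (intro AE_finite_allI) auto
  ultimately show ?thesis
  proof eventually_elim
    case (elim w)
    have "(\<lambda>t. Jseq mu c gam (?xs w) t i) \<longlonglongrightarrow> V i" if "i \<in> S" for i
    proof (rule greedy_iteration_tendsto_V[where m = "\<lambda>t. mu (H t w)" and a = "a w" and e = "e w"])
      show "Qval n P c (Jseq mu c gam (?xs w) t) i (mu (H t w) i) \<le> Qval n P c (Jseq mu c gam (?xs w) t) i u"
        if "i \<in> S" "u \<in> A i" for t i u
        using greedy[rule_format, of i "H t w"] that by (simp add: Jseq_H)
    qed (use elim rec that mu_policy gam_range in \<open>auto simp: a_def\<close>)
    then show ?case using Jstar_eq_V by simp
  qed
qed

end
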